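(* Let $A\in\mathbb{R}^{d_1\times d_2}$, $d=\max\{d_1,d_2\}$, $n>0$, and let $1\le r<d$ with $\sigma_r(A)>\sigma_{r+1}(A)$. Let the entries $\omega_{ij}$ of $\Omega$ be independent Bernoulli variables with $\mathbb{P}(\omega_{ij}=1)=p_{ij}$, where $$p_{ij}=\min\left\{\frac{n}{2}\left(\frac{a_{ij}^2}{\|A\|_{\mathrm F}^2}+\frac{|a_{ij}|}{\|A\|_{\ell_1}}\right),1\right\}.$$ Then there exist numerical constants $C_1,C_2>0$ such that for any $\alpha>0$, $$\|[\mathcal P_\Omega(A)]_r-A_r\|_{\mathrm F}\le C_1\|A\|_{\mathrm F}\sqrt{\frac{rd}{n}}\left(1+\frac{\sqrt{\sigma_{r+1}(A)\sigma_1(A)}}{\sigma_r(A)-\sigma_{r+1}(A)}\right)$$ with probability at least $1-d^{-\alpha}$, provided that $$n\ge C_2 d\max\left\{(1+\alpha)\log d,\ \frac{\|A\|_{\mathrm F}^2}{(\sigma_r(A)-\sigma_{r+1}(A))^2}\right\}.$$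
   Context: $\mathcal P_\Omega(A)$ denotes the $d_1\times d_2$ matrix with entries $a_{ij}\omega_{ij}/p_{ij}$, with the convention $0/0=0$. For a matrix $M$, $\sigma_1(M)\ge\sigma_2(M)\ge\cdots$ are its singular values and $M_r$ is its best rank-$r$ approximation (truncated SVD). $\|A\|_{\ell_1}=\sum_{i,j}|a_{ij}|$, $\|\cdot\|_{\mathrm F}$ is the Frobenius norm. *)

theory Defs
  imports "HOL-Probability.Probability"
begin

text \<open>Matrices of size d1 x d2 are represented as functions nat => nat => real;
  only entries with i < d1, j < d2 are relevant (indices are 0-based).\<close>

definition fro_norm :: "nat \<Rightarrow> nat \<Rightarrow> (nat \<Rightarrow> nat \<Rightarrow> real) \<Rightarrow> real" where
  "fro_norm d1 d2 M = sqrt (\<Sum>i<d1. \<Sum>j<d2. (M i j)\<^sup>2)"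

definition l1_norm :: "nat \<Rightarrow> nat \<Rightarrow> (nat \<Rightarrow> nat \<Rightarrow> real) \<Rightarrow> real" where
  "l1_norm d1 d2 M = (\<Sum>i<d1. \<Sum>j<d2. \<bar>M i j\<bar>)"

definition is_svd :: "nat \<Rightarrow> nat \<Rightarrow> (nat \<Rightarrow> nat \<Rightarrow> real) \<Rightarrow> (nat \<Rightarrow> nat \<Rightarrow> real)
    \<Rightarrow> (nat \<Rightarrow> nat \<Rightarrow> real) \<Rightarrow> (nat \<Rightarrow> real) \<Rightarrow> bool" where
  "is_svd d1 d2 M U V s \<longleftrightarrow>
     (\<forall>l<min d1 d2. \<forall>l'<min d1 d2. (\<Sum>i<d1. U i l * U i l') = (if l = l' then 1 else 0)) \<and>
     (\<forall>l<min d1 d2. \<forall>l'<min d1 d2. (\<Sum>j<d2. V j l * V j l') = (if l = l' then 1 else 0)) \<and>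
     (\<forall>l<min d1 d2. 0 \<le> s l) \<and>
     (\<forall>l l'. l \<le> l' \<and> l' < min d1 d2 \<longrightarrow> s l' \<le> s l) \<and>
     (\<forall>i<d1. \<forall>j<d2. M i j = (\<Sum>l<min d1 d2. s l * U i l * V j l))"

text \<open>Singular values, 1-indexed: sigma_1 >= sigma_2 >= ...; zero beyond min d1 d2.\<close>
definition sing_val :: "nat \<Rightarrow> nat \<Rightarrow> (nat \<Rightarrow> nat \<Rightarrow> real) \<Rightarrow> nat \<Rightarrow> real" where
  "sing_val d1 d2 M j =
     (if 1 \<le> j \<and> j \<le> min d1 d2
      then (THE x. \<exists>U V s. is_svd d1 d2 M U V s \<and> x = s (j - 1))
      else 0)"

text \<open>B is a best rank-r approximation of M obtained by truncating an SVD of M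
  (not unique when sigma_r = sigma_{r+1}).\<close>
definition is_trunc_svd :: "nat \<Rightarrow> nat \<Rightarrow> (nat \<Rightarrow> nat \<Rightarrow> real) \<Rightarrow> nat
    \<Rightarrow> (nat \<Rightarrow> nat \<Rightarrow> real) \<Rightarrow> bool" where
  "is_trunc_svd d1 d2 M r B \<longleftrightarrow>
     (\<exists>U V s. is_svd d1 d2 M U V s \<and>
        (\<forall>i<d1. \<forall>j<d2. B i j = (\<Sum>l<min r (min d1 d2). s l * U i l * V j l)))"

text \<open>P_Omega(A): entries a_ij omega_ij / p_ij (with x / 0 = 0).\<close>
definition P_Omega :: "(nat \<times> nat \<Rightarrow> bool) \<Rightarrow> (nat \<Rightarrow> nat \<Rightarrow> real) \<Rightarrow> (nat \<Rightarrow> nat \<Rightarrow> real)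
    \<Rightarrow> (nat \<Rightarrow> nat \<Rightarrow> real)" where
  "P_Omega \<omega> p A = (\<lambda>i j. A i j * (if \<omega> (i, j) then 1 else 0) / p i j)"

definition samp_prob :: "nat \<Rightarrow> nat \<Rightarrow> real \<Rightarrow> (nat \<Rightarrow> nat \<Rightarrow> real) \<Rightarrow> nat \<Rightarrow> nat \<Rightarrow> real" where
  "samp_prob d1 d2 n A i j =
     min (n / 2 * ((A i j)\<^sup>2 / (fro_norm d1 d2 A)\<^sup>2 + \<bar>A i j\<bar> / l1_norm d1 d2 A)) 1"

definition Omega_pmf :: "nat \<Rightarrow> nat \<Rightarrow> (nat \<Rightarrow> nat \<Rightarrow> real) \<Rightarrow> (nat \<times> nat \<Rightarrow> bool) pmf" where
  "Omega_pmf d1 d2 p = Pi_pmf ({..<d1} \<times> {..<d2}) False (\<lambda>(i, j). bernoulli_pmf (p i j))"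

end

theory Submission
  imports Defs
begin

text \<open>
  Write \<open>E = P\<^sub>\<Omega>(A) - A\<close>. Deterministically, if \<open>\<parallel>E\<parallel>\<close> is at most half the spectral gap, Weyl's inequality and
  Wedin's argument, applied to each singular vector separately, bound the sines of the angles between the
  leading singular spaces by \<open>2 \<parallel>E\<parallel> / gap\<close>, and the truncation error follows by splitting it along the
  leading right singular space of \<open>P\<^sub>\<Omega>(A)\<close>.

  The norm of \<open>E\<close> has to be bounded without the logarithmic factor of a matrix Bernstein inequality.
  After scaling, the entries of \<open>E\<close> are centred, bounded by 1 and have variance at most \<open>q / d\<close>
  with \<open>q = n / (2 d)\<close>. In the expansion of the expected trace of \<open>(E E\<^sup>T)\<^sup>k\<close> only closed walks without
  simple edges survive. For \<open>k\<close> of order \<open>q\<close>, relabelling vertices turns their weighted number into the plain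
  number of such walks on \<open>3 k\<close> labels, at the price of a factor \<open>d\<close>. That number is at most the expected trace
  power of a \<open>3 k \<times> 3 k\<close> matrix with independent centred subgaussian entries whose higher moments are at
  least 1, for which a net argument gives the bound \<open>(C k)\<^sup>k\<close>.
\<close>

section \<open>Perturbation of truncated singular value decompositions\<close>

text \<open>The error matrix itself resists a net argument: a scaled entry that can have size 1 but
  has variance only \<open>q / d\<close> is not subgaussian at the scale of its standard deviation,
  and a union bound over a net in dimension \<open>d\<close> is then too expensive. On
  \<open>3 * k\<close> labels a net has only a constant to the power \<open>k\<close> many points,
  which disappears into the constant once the root of a moment of order \<open>2 * k\<close> is
  taken.

  Two demands fix \<open>k\<close>. Markov's inequality has to beat the factor \<open>d\<close> and
  still leave \<open>d powr (- \<alpha>)\<close>, so \<open>k\<close> must be at least of order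
  \<open>(1 + \<alpha>) * ln d\<close>. The resulting norm bound is of order \<open>sqrt k\<close>,
  while the target is \<open>sqrt q\<close>, the possible norm of a row with \<open>d\<close>
  entries of variance \<open>q / d\<close>; so \<open>k\<close> may exceed \<open>q\<close> at most
  by a constant factor. The logarithmic part of the condition on \<open>n\<close> makes the two
  demands compatible, and the other part keeps the error below half the gap.\<close>

definition ip :: "nat \<Rightarrow> (nat \<Rightarrow> real) \<Rightarrow> (nat \<Rightarrow> real) \<Rightarrow> real" where
  "ip d x y = (\<Sum>i<d. x i * y i)"

definition vnorm :: "nat \<Rightarrow> (nat \<Rightarrow> real) \<Rightarrow> real" where
  "vnorm d x = L2_set x {..<d}"

definition mv :: "nat \<Rightarrow> (nat \<Rightarrow> nat \<Rightarrow> real) \<Rightarrow> (nat \<Rightarrow> real) \<Rightarrow> nat \<Rightarrow> real" where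
  "mv d M x = (\<lambda>i. \<Sum>j<d. M i j * x j)"

text \<open>An upper bound for the spectral norm as a predicate: only upper estimates occur, so no
  supremum has to be handled.\<close>

definition op_bounded :: "nat \<Rightarrow> nat \<Rightarrow> (nat \<Rightarrow> nat \<Rightarrow> real) \<Rightarrow> real \<Rightarrow> bool" where
  "op_bounded d1 d2 M c \<longleftrightarrow> (\<forall>x. vnorm d1 (mv d2 M x) \<le> c * vnorm d2 x)"

definition orthonormal :: "nat \<Rightarrow> nat set \<Rightarrow> (nat \<Rightarrow> nat \<Rightarrow> real) \<Rightarrow> bool" where
  "orthonormal d S U \<longleftrightarrow> (\<forall>l\<in>S. \<forall>l'\<in>S. (\<Sum>i<d. U i l * U i l') = (if l = l' then 1 else 0))"

text \<open>For orthonormal columns and a unit vector \<open>x\<close>, the norm of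
  \<open>perp d r U x\<close> is the sine of the angle between \<open>x\<close> and the span of the
  first \<open>r\<close> columns.\<close>

definition perp :: "nat \<Rightarrow> nat \<Rightarrow> (nat \<Rightarrow> nat \<Rightarrow> real) \<Rightarrow> (nat \<Rightarrow> real) \<Rightarrow> nat \<Rightarrow> real" where
  "perp d r U x = (\<lambda>i. x i - (\<Sum>l<r. ip d (\<lambda>i. U i l) x * U i l))"

lemma vnorm_nonneg [simp]: "0 \<le> vnorm d x"
  by (simp add: vnorm_def)

lemma vnorm_power2: "(vnorm d x)\<^sup>2 = (\<Sum>i<d. (x i)\<^sup>2)"
  by (simp add: vnorm_def L2_set_def sum_nonneg)

lemma vnorm_power2_ip: "(vnorm d x)\<^sup>2 = ip d x x"
  unfolding vnorm_power2 ip_def by (simp add: power2_eq_square)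

lemma ip_commute: "ip d x y = ip d y x"
  by (simp add: ip_def mult.commute)

lemma ip_cong: "(\<And>i. i < d \<Longrightarrow> x i = x' i) \<Longrightarrow> (\<And>i. i < d \<Longrightarrow> y i = y' i) \<Longrightarrow> ip d x y = ip d x' y'"
  by (simp add: ip_def)

lemma vnorm_cong: "(\<And>i. i < d \<Longrightarrow> x i = x' i) \<Longrightarrow> vnorm d x = vnorm d x'"
  unfolding vnorm_def by (rule L2_set_cong) auto

lemma ip_add_right: "ip d x (\<lambda>i. y i + z i) = ip d x y + ip d x z"
  by (simp add: ip_def algebra_simps sum.distrib)

lemma ip_diff_right: "ip d x (\<lambda>i. y i - z i) = ip d x y - ip d x z"
  by (simp add: ip_def algebra_simps sum_subtractf)

lemma ip_scale_right: "ip d x (\<lambda>i. c * y i) = c * ip d x y"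
  by (simp add: ip_def sum_distrib_left algebra_simps)

lemma ip_sum_right: "ip d x (\<lambda>i. \<Sum>l\<in>S. f l i) = (\<Sum>l\<in>S. ip d x (f l))"
  unfolding ip_def by (simp add: sum_distrib_left sum.swap[of _ S])

lemma ip_Cauchy_Schwarz: "\<bar>ip d x y\<bar> \<le> vnorm d x * vnorm d y"
proof -
  have "\<bar>ip d x y\<bar> \<le> (\<Sum>i<d. \<bar>x i\<bar> * \<bar>y i\<bar>)"
    unfolding ip_def by (rule order_trans[OF sum_abs]) (simp add: abs_mult)
  also have "\<dots> \<le> vnorm d x * vnorm d y"
    unfolding vnorm_def by (rule L2_set_mult_ineq)
  finally show ?thesis .
qed

lemma vnorm_triangle: "vnorm d (\<lambda>i. x i + y i) \<le> vnorm d x + vnorm d y"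
  by (simp add: vnorm_def L2_set_triangle_ineq)

lemma vnorm_scale: "vnorm d (\<lambda>i. c * x i) = \<bar>c\<bar> * vnorm d x"
  unfolding vnorm_def L2_set_def
  by (simp add: power_mult_distrib flip: sum_distrib_left) (simp add: real_sqrt_mult)

lemma mv_ip: "mv d M x i = ip d (M i) x"
  by (simp add: mv_def ip_def)

lemma ip_mv: "ip d1 y (mv d2 M x) = ip d2 (mv d1 (\<lambda>i j. M j i) y) x"
  unfolding ip_def mv_def
  by (simp add: sum_distrib_left sum_distrib_right mult_ac) (rule sum.swap)

text \<open>Pair the vector M^T y with itself, move one M^T to the other side, and cancel a factor
  of its norm.\<close>

lemma op_bounded_transpose:
  assumes "op_bounded d1 d2 M c" and "c \<ge> 0"
  shows "op_bounded d2 d1 (\<lambda>i j. M j i) c"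
  unfolding op_bounded_def
proof
  fix y
  let ?z = "mv d1 (\<lambda>i j. M j i) y"
  have "(vnorm d2 ?z)\<^sup>2 = ip d1 y (mv d2 M ?z)"
    by (simp add: ip_mv vnorm_power2_ip)
  also have "\<dots> \<le> vnorm d1 y * vnorm d1 (mv d2 M ?z)"
    using ip_Cauchy_Schwarz abs_le_D1 by blast
  also have "\<dots> \<le> vnorm d1 y * (c * vnorm d2 ?z)"
    using assms by (intro mult_left_mono) (auto simp: op_bounded_def)
  finally have *: "vnorm d2 ?z * vnorm d2 ?z \<le> (c * vnorm d1 y) * vnorm d2 ?z"
    by (simp add: power2_eq_square mult_ac)
  show "vnorm d2 ?z \<le> c * vnorm d1 y"
  proof (cases "vnorm d2 ?z = 0")
    case False
    then show ?thesis using * by (simp add: order_less_le)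
  qed (use assms in simp)
qed

lemma ip_orthonormal:
  "orthonormal d S U \<Longrightarrow> l \<in> S \<Longrightarrow> l' \<in> S \<Longrightarrow> ip d (\<lambda>i. U i l) (\<lambda>i. U i l') = (if l = l' then 1 else 0)"
  by (simp add: orthonormal_def ip_def)

lemma orthonormal_mono: "orthonormal d S U \<Longrightarrow> T \<subseteq> S \<Longrightarrow> orthonormal d T U"
  unfolding orthonormal_def by (meson subsetD)

lemma ip_orthonormal_sum:
  assumes "orthonormal d S U" "finite T" "T \<subseteq> S" "l \<in> S"
  shows "ip d (\<lambda>i. U i l) (\<lambda>i. \<Sum>k\<in>T. c k * U i k) = (if l \<in> T then c l else 0)"
proof -
  have "ip d (\<lambda>i. U i l) (\<lambda>i. \<Sum>k\<in>T. c k * U i k) = (\<Sum>k\<in>T. if l = k then c k else 0)"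
    unfolding ip_sum_right ip_scale_right
    using assms(3) by (intro sum.cong refl) (simp add: ip_orthonormal[OF assms(1,4)] subset_iff)
  then show ?thesis using assms(2) by simp
qed

lemma vnorm_orthonormal_sum:
  assumes "orthonormal d S U" "finite S"
  shows "(vnorm d (\<lambda>i. \<Sum>k\<in>S. c k * U i k))\<^sup>2 = (\<Sum>k\<in>S. (c k)\<^sup>2)"
proof -
  let ?x = "\<lambda>i. \<Sum>k\<in>S. c k * U i k"
  have "ip d ?x ?x
      = (\<Sum>l\<in>S. c l * ip d (\<lambda>i. U i l) (\<lambda>i. \<Sum>k\<in>S. c k * U i k))"
    using ip_sum_right[of d ?x "\<lambda>k i. c k * U i k" S]
    by (simp only: ip_scale_right ip_commute[of d ?x "\<lambda>i. U i _"])
  also have "\<dots> = (\<Sum>k\<in>S. (c k)\<^sup>2)"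
    using ip_orthonormal_sum[OF assms subset_refl] by (simp add: power2_eq_square)
  finally show ?thesis by (simp add: vnorm_power2_ip)
qed

lemma vnorm_orthonormal:
  assumes "orthonormal d S U" "l \<in> S"
  shows "vnorm d (\<lambda>i. U i l) = 1"
  using ip_orthonormal[OF assms(1) assms(2) assms(2)] vnorm_power2_ip[of d "\<lambda>i. U i l"]
  by (simp add: power2_eq_1_iff) (smt (verit) vnorm_nonneg)

lemma Pythagoras_residual:
  assumes "orthonormal d S U" "finite S"
  shows "(vnorm d (\<lambda>i. x i - (\<Sum>l\<in>S. ip d (\<lambda>i. U i l) x * U i l)))\<^sup>2
       = (vnorm d x)\<^sup>2 - (\<Sum>l\<in>S. (ip d (\<lambda>i. U i l) x)\<^sup>2)"
proof -
  let ?c = "\<lambda>l. ip d (\<lambda>i. U i l) x"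
  let ?p = "\<lambda>i. \<Sum>l\<in>S. ?c l * U i l"
  have 1: "ip d x ?p = (\<Sum>l\<in>S. (?c l)\<^sup>2)"
    by (simp add: ip_sum_right ip_scale_right power2_eq_square ip_commute[of d x])
  have 2: "ip d ?p ?p = (\<Sum>l\<in>S. (?c l)\<^sup>2)"
    using vnorm_orthonormal_sum[OF assms, of ?c] by (simp add: vnorm_power2_ip)
  have "ip d (\<lambda>i. x i - ?p i) (\<lambda>i. x i - ?p i) = ip d x x - 2 * ip d x ?p + ip d ?p ?p"
    by (subst ip_diff_right, subst (1 2) ip_commute, subst (1 2) ip_diff_right)
      (simp add: ip_commute)
  then show ?thesis by (simp add: vnorm_power2_ip 1 2)
qed

lemma Bessel:
  assumes "orthonormal d S U" "finite S"
  shows "(\<Sum>l\<in>S. (ip d (\<lambda>i. U i l) x)\<^sup>2) \<le> (vnorm d x)\<^sup>2"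
  using Pythagoras_residual[OF assms, of x] by (smt (verit) zero_le_power2)

lemma vnorm_perp_le:
  assumes "orthonormal d {..<r} U"
  shows "vnorm d (perp d r U x) \<le> vnorm d x"
proof (rule power2_le_imp_le)
  show "(vnorm d (perp d r U x))\<^sup>2 \<le> (vnorm d x)\<^sup>2"
    unfolding perp_def Pythagoras_residual[OF assms finite_lessThan]
    by (simp add: sum_nonneg)
qed simp

lemma perp_add: "perp d r U (\<lambda>i. x i + y i) i = perp d r U x i + perp d r U y i"
  by (simp add: perp_def ip_add_right algebra_simps sum.distrib)

lemma perp_scale: "perp d r U (\<lambda>i. c * x i) i = c * perp d r U x i"
  by (simp add: perp_def ip_scale_right algebra_simps sum_distrib_left)

lemma perp_cong: "(\<And>i. i < d \<Longrightarrow> x i = y i) \<Longrightarrow> i < d \<Longrightarrow> perp d r U x i = perp d r U y i"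
  using ip_cong[of d _ _ x y] by (simp add: perp_def)

lemma perp_orthonormal_sum:
  assumes "orthonormal d {..<m} U" "r \<le> m"
  shows "perp d r U (\<lambda>i. \<Sum>k<m. c k * U i k) i = (\<Sum>k\<in>{r..<m}. c k * U i k)"
proof -
  have "(\<Sum>l<r. ip d (\<lambda>i. U i l) (\<lambda>i. \<Sum>k<m. c k * U i k) * U i l) = (\<Sum>l<r. c l * U i l)"
    using ip_orthonormal_sum[OF assms(1) finite_lessThan subset_refl] assms(2)
    by (intro sum.cong refl) auto
  moreover have "(\<Sum>k<m. c k * U i k) = (\<Sum>l<r. c l * U i l) + (\<Sum>k\<in>{r..<m}. c k * U i k)"
    using assms(2) by (simp add: sum.atLeastLessThan_concat flip: atLeast0LessThan)
  ultimately show ?thesis by (simp add: perp_def)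
qed

lemma ip_perp:
  assumes "orthonormal d {..<m} U" "r \<le> k" "k < m"
  shows "ip d (\<lambda>i. U i k) (perp d r U x) = ip d (\<lambda>i. U i k) x"
  unfolding perp_def ip_diff_right
  using ip_orthonormal_sum[OF assms(1), of "{..<r}" k "\<lambda>l. ip d (\<lambda>i. U i l) x"] assms(2,3) by auto


section \<open>Singular value decompositions as linear maps, and Wedin's argument\<close>

lemma is_svd_orthonormal:
  assumes "is_svd d1 d2 M U V s"
  shows "orthonormal d1 {..<min d1 d2} U" "orthonormal d2 {..<min d1 d2} V"
  using assms unfolding is_svd_def orthonormal_def by blast+

lemma is_svd_transpose:
  "is_svd d1 d2 M U V s \<Longrightarrow> is_svd d2 d1 (\<lambda>i j. M j i) V U s"
  unfolding is_svd_def min.commute[of d2 d1] by (auto simp: mult_ac)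

lemma is_svd_decreasing:
  "is_svd d1 d2 M U V s \<Longrightarrow> l \<le> l' \<Longrightarrow> l' < min d1 d2 \<Longrightarrow> s l' \<le> s l"
  unfolding is_svd_def by blast

lemma is_svd_nonneg:
  "is_svd d1 d2 M U V s \<Longrightarrow> l < min d1 d2 \<Longrightarrow> 0 \<le> s l"
  unfolding is_svd_def by blast

lemma svd_mv:
  assumes "is_svd d1 d2 M U V s" "i < d1"
  shows "mv d2 M x i = (\<Sum>l<min d1 d2. s l * ip d2 (\<lambda>j. V j l) x * U i l)"
proof -
  have "mv d2 M x i = (\<Sum>j<d2. (\<Sum>l<min d1 d2. s l * U i l * V j l) * x j)"
    using assms unfolding mv_def is_svd_def by (intro sum.cong) auto
  also have "\<dots> = (\<Sum>l<min d1 d2. s l * ip d2 (\<lambda>j. V j l) x * U i l)"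
    unfolding ip_def sum_distrib_left sum_distrib_right
    by (subst sum.swap) (simp add: mult_ac)
  finally show ?thesis .
qed

lemma svd_mv_right_vector:
  assumes "is_svd d1 d2 M U V s" "i < d1" "l < min d1 d2"
  shows "mv d2 M (\<lambda>j. V j l) i = s l * U i l"
proof -
  have "mv d2 M (\<lambda>j. V j l) i = (\<Sum>k<min d1 d2. if k = l then s k * U i k else 0)"
    unfolding svd_mv[OF assms(1,2)]
    using ip_orthonormal[OF is_svd_orthonormal(2)[OF assms(1)]] assms(3)
    by (intro sum.cong) auto
  then show ?thesis using assms(3) by simp
qed

lemma mv_add: "mv d (\<lambda>i j. A i j + B i j) x i = mv d A x i + mv d B x i"
  by (simp add: mv_def algebra_simps sum.distrib)

text \<open>For \<open>r \<le> k\<close> the coefficient of \<open>x\<close> along the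
  \<open>k\<close>-th right singular vector is also that of the perpendicular part, so Bessel
  applies to that part. The gain is that a sine appears on the right instead of the norm of
  \<open>x\<close>.\<close>

lemma svd_tail_bound:
  assumes svd: "is_svd d1 d2 M U V s" and r: "r \<le> min d1 d2"
    and tail: "\<And>k. r \<le> k \<Longrightarrow> k < min d1 d2 \<Longrightarrow> s k \<le> t" and t: "0 \<le> t"
  shows "vnorm d1 (\<lambda>i. \<Sum>k\<in>{r..<min d1 d2}. s k * ip d2 (\<lambda>j. V j k) x * U i k)
    \<le> t * vnorm d2 (perp d2 r V x)"
proof (rule power2_le_imp_le)
  let ?m = "min d1 d2" let ?y = "perp d2 r V x"
  note onU = orthonormal_mono[OF is_svd_orthonormal(1)[OF svd], of "{r..<?m}"]
  note onV = orthonormal_mono[OF is_svd_orthonormal(2)[OF svd], of "{r..<?m}"]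
  have "(vnorm d1 (\<lambda>i. \<Sum>k\<in>{r..<?m}. s k * ip d2 (\<lambda>j. V j k) x * U i k))\<^sup>2
      = (\<Sum>k\<in>{r..<?m}. (s k)\<^sup>2 * (ip d2 (\<lambda>j. V j k) ?y)\<^sup>2)"
    by (subst vnorm_orthonormal_sum[OF onU]) (auto simp: power_mult_distrib intro!: sum.cong
        simp: ip_perp[OF is_svd_orthonormal(2)[OF svd]])
  also have "\<dots> \<le> (\<Sum>k\<in>{r..<?m}. t\<^sup>2 * (ip d2 (\<lambda>j. V j k) ?y)\<^sup>2)"
    using tail is_svd_nonneg[OF svd] by (intro sum_mono mult_right_mono power_mono) auto
  also have "\<dots> \<le> t\<^sup>2 * (vnorm d2 ?y)\<^sup>2"
    unfolding sum_distrib_left[symmetric]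
    by (intro mult_left_mono Bessel onV) auto
  finally show "(vnorm d1 (\<lambda>i. \<Sum>k\<in>{r..<?m}. s k * ip d2 (\<lambda>j. V j k) x * U i k))\<^sup>2
      \<le> (t * vnorm d2 ?y)\<^sup>2" by (simp add: power_mult_distrib)
qed (use t in simp)

lemma op_bounded_uminus:
  "op_bounded d1 d2 (\<lambda>i j. A i j - B i j) c \<longleftrightarrow> op_bounded d1 d2 (\<lambda>i j. B i j - A i j) c"
proof -
  have "mv d2 (\<lambda>i j. B i j - A i j) x = (\<lambda>i. (-1) * mv d2 (\<lambda>i j. A i j - B i j) x i)" for x
    by (simp add: mv_def fun_eq_iff algebra_simps sum_subtractf)
  then show ?thesis unfolding op_bounded_def by (simp only: vnorm_scale) simp
qed

text \<open>Write \<open>s l\<close> times the \<open>l\<close>-th left vector of \<open>A\<close>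
  as the image of the right one under \<open>M\<close> plus its image under \<open>A - M\<close>,
  and project off the first \<open>r\<close> left vectors of \<open>M\<close>. The projection leaves
  only the tail of \<open>M\<close>, which the sine on the right-hand side controls.\<close>

lemma Wedin_left:
  assumes svdA: "is_svd d1 d2 A U V s" and svdM: "is_svd d1 d2 M U' V' s'"
    and E: "op_bounded d1 d2 (\<lambda>i j. A i j - M i j) e"
    and r: "r \<le> min d1 d2" "l < r"
    and tail: "\<And>k. r \<le> k \<Longrightarrow> k < min d1 d2 \<Longrightarrow> s' k \<le> t" "0 \<le> t"
  shows "s l * vnorm d1 (perp d1 r U' (\<lambda>i. U i l)) \<le> t * vnorm d2 (perp d2 r V' (\<lambda>j. V j l)) + e"
proof -
  let ?m = "min d1 d2" let ?v = "\<lambda>j. V j l" let ?E = "\<lambda>i j. A i j - M i j"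
  have lm: "l < ?m" using r by auto
  have eq: "s l * perp d1 r U' (\<lambda>i. U i l) i
      = (\<Sum>k\<in>{r..<?m}. s' k * ip d2 (\<lambda>j. V' j k) ?v * U' i k) + perp d1 r U' (mv d2 ?E ?v) i"
    if "i < d1" for i
  proof -
    have "s l * perp d1 r U' (\<lambda>i. U i l) i = perp d1 r U' (\<lambda>i. s l * U i l) i"
      by (simp add: perp_scale)
    also have "\<dots> = perp d1 r U' (\<lambda>i. (\<Sum>k<?m. s' k * ip d2 (\<lambda>j. V' j k) ?v * U' i k) + mv d2 ?E ?v i) i"
    proof (rule perp_cong[OF _ that])
      fix i assume i: "i < d1"
      have "mv d2 A ?v i = mv d2 M ?v i + mv d2 ?E ?v i" by (subst mv_add[symmetric]) simp
      then show "s l * U i l = (\<Sum>k<?m. s' k * ip d2 (\<lambda>j. V' j k) ?v * U' i k) + mv d2 ?E ?v i"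
        by (simp only: svd_mv_right_vector[OF svdA i lm] svd_mv[OF svdM i])
    qed
    also have "\<dots> = (\<Sum>k\<in>{r..<?m}. s' k * ip d2 (\<lambda>j. V' j k) ?v * U' i k) + perp d1 r U' (mv d2 ?E ?v) i"
      unfolding perp_add by (simp only: perp_orthonormal_sum[OF is_svd_orthonormal(1)[OF svdM] r(1)])
    finally show ?thesis .
  qed
  have "s l * vnorm d1 (perp d1 r U' (\<lambda>i. U i l)) = vnorm d1 (\<lambda>i. s l * perp d1 r U' (\<lambda>i. U i l) i)"
    using is_svd_nonneg[OF svdA lm] by (simp add: vnorm_scale)
  also have "\<dots> = vnorm d1 (\<lambda>i. (\<Sum>k\<in>{r..<?m}. s' k * ip d2 (\<lambda>j. V' j k) ?v * U' i k)
      + perp d1 r U' (mv d2 ?E ?v) i)"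
    by (rule vnorm_cong) (rule eq)
  also have "\<dots> \<le> vnorm d1 (\<lambda>i. \<Sum>k\<in>{r..<?m}. s' k * ip d2 (\<lambda>j. V' j k) ?v * U' i k)
      + vnorm d1 (perp d1 r U' (mv d2 ?E ?v))"
    by (rule vnorm_triangle)
  also have "\<dots> \<le> t * vnorm d2 (perp d2 r V' ?v) + vnorm d1 (mv d2 ?E ?v)"
    using r by (intro add_mono svd_tail_bound[OF svdM r(1) tail] vnorm_perp_le
        orthonormal_mono[OF is_svd_orthonormal(1)[OF svdM]]) auto
  also have "vnorm d1 (mv d2 ?E ?v) \<le> e"
    using E vnorm_orthonormal[OF is_svd_orthonormal(2)[OF svdA], of l] lm
    unfolding op_bounded_def by (metis lessThan_iff mult.right_neutral)
  finally show ?thesis by simp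
qed

lemma Wedin_right:
  assumes svdA: "is_svd d1 d2 A U V s" and svdM: "is_svd d1 d2 M U' V' s'"
    and E: "op_bounded d1 d2 (\<lambda>i j. A i j - M i j) e" "0 \<le> e"
    and r: "r \<le> min d1 d2" "l < r"
    and tail: "\<And>k. r \<le> k \<Longrightarrow> k < min d1 d2 \<Longrightarrow> s' k \<le> t" "0 \<le> t"
  shows "s l * vnorm d2 (perp d2 r V' (\<lambda>i. V i l)) \<le> t * vnorm d1 (perp d1 r U' (\<lambda>j. U j l)) + e"
  by (rule Wedin_left[OF is_svd_transpose[OF svdA] is_svd_transpose[OF svdM] op_bounded_transpose[OF E]])
    (use r tail in \<open>auto simp: min.commute\<close>)

text \<open>Combining the two estimates absorbs the coupling between left and right singular vectors.\<close>

lemma Wedin_angle: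
  assumes svdA: "is_svd d1 d2 A U V s" and svdM: "is_svd d1 d2 M U' V' s'"
    and E: "op_bounded d1 d2 (\<lambda>i j. A i j - M i j) e" "0 \<le> e"
    and r: "r \<le> min d1 d2" "l < r"
    and tail: "\<And>k. r \<le> k \<Longrightarrow> k < min d1 d2 \<Longrightarrow> s' k \<le> t" "0 \<le> t"
    and g: "0 < g" "t + g \<le> s l"
  shows "vnorm d1 (perp d1 r U' (\<lambda>i. U i l)) \<le> e / g" "vnorm d2 (perp d2 r V' (\<lambda>i. V i l)) \<le> e / g"
proof -
  define a where "a = vnorm d1 (perp d1 r U' (\<lambda>i. U i l))"
  define b where "b = vnorm d2 (perp d2 r V' (\<lambda>i. V i l))"
  have ab: "s l * a \<le> t * b + e" "s l * b \<le> t * a + e"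
    using Wedin_left[OF svdA svdM E(1) r tail] Wedin_right[OF svdA svdM E r tail]
    by (simp_all add: a_def b_def)
  have nn: "a \<ge> 0" "b \<ge> 0" by (simp_all add: a_def b_def)
  have *: "x \<le> e / g" if "y \<le> x" "s l * x \<le> t * y + e" "0 \<le> x" for x y
  proof -
    have "(t + g) * x \<le> s l * x" "t * y \<le> t * x"
      using that g tail by (auto intro: mult_right_mono mult_left_mono)
    then have "g * x \<le> e" using that by (simp add: algebra_simps)
    then show ?thesis using g by (simp add: field_simps)
  qed
  have "max a b \<le> e / g"
    using *[of a b] *[of b a] ab nn by (cases "a \<le> b") auto
  then show "vnorm d1 (perp d1 r U' (\<lambda>i. U i l)) \<le> e / g" "vnorm d2 (perp d2 r V' (\<lambda>i. V i l)) \<le> e / g"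
    by (auto simp: a_def b_def)
qed

section \<open>Weyl's inequality and uniqueness of singular values\<close>

text \<open>Gaussian elimination of the last unknown. If it occurs in no equation, its unit vector
  is a solution; otherwise a pivot equation removes it from all others.\<close>

lemma homogeneous_system:
  fixes a :: "nat \<Rightarrow> nat \<Rightarrow> real"
  assumes "m < n"
  shows "\<exists>x. (\<exists>j<n. x j \<noteq> 0) \<and> (\<forall>i<m. (\<Sum>j<n. a i j * x j) = 0)"
  using assms
proof (induction n arbitrary: m a)
  case 0
  then show ?case by simp
next
  case (Suc n)
  show ?case
  proof (cases "\<exists>p<m. a p n \<noteq> 0")
    case False
    then show ?thesis
      by (intro exI[of _ "\<lambda>j. if j = n then 1 else 0"]) auto
  next
    case True
    then obtain p where p: "p < m" "a p n \<noteq> 0" by blast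
    \<comment> \<open>\<open>q\<close> enumerates the equations other than the pivot
      \<open>p\<close>.\<close>
    define q where "q i = (if i < p then i else Suc i)" for i
    define b where "b i j = a (q i) j - a (q i) n / a p n * a p j" for i j
    have "m - 1 < n" using Suc.prems p by auto
    from Suc.IH[OF this, of b] obtain x where
      x: "\<exists>j<n. x j \<noteq> 0" "\<forall>i<m-1. (\<Sum>j<n. b i j * x j) = 0" by blast
    define y where "y j = (if j = n then - (\<Sum>j<n. a p j * x j) / a p n else x j)" for j
    have sumy: "(\<Sum>j<Suc n. a i j * y j) = (\<Sum>j<n. a i j * x j) - a i n / a p n * (\<Sum>j<n. a p j * x j)" for i
      by (simp add: y_def)
    have "(\<Sum>j<Suc n. a i j * y j) = 0" if "i < m" for i
    proof (cases "i = p")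
      case True
      then show ?thesis unfolding sumy using p by simp
    next
      case False
      define i' where "i' = (if i < p then i else i - 1)"
      have i': "q i' = i" "i' < m - 1" using False that p by (auto simp: q_def i'_def)
      have "0 = (\<Sum>j<n. b i' j * x j)" using x(2) i' by simp
      also have "\<dots> = (\<Sum>j<n. a i j * x j) - a i n / a p n * (\<Sum>j<n. a p j * x j)"
        by (simp add: b_def i' algebra_simps sum_subtractf sum_distrib_left)
      finally show ?thesis using sumy by simp
    qed
    moreover have "\<exists>j<Suc n. y j \<noteq> 0" using x(1) by (auto simp: y_def)
    ultimately show ?thesis by blast
  qed
qed

text \<open>Dimension count: in the span of the first \<open>l + 1\<close> right singular vectors of
  \<open>A\<close> there is a nonzero \<open>x\<close> orthogonal to the first \<open>l\<close>
  right singular vectors of \<open>M\<close>. On this \<open>x\<close>, \<open>A\<close> stretches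
  by at least \<open>s l\<close> and \<open>M\<close> by at most \<open>s' l\<close>.\<close>

lemma Weyl:
  assumes svdA: "is_svd d1 d2 A U V s" and svdM: "is_svd d1 d2 M U' V' s'"
    and E: "op_bounded d1 d2 (\<lambda>i j. A i j - M i j) e"
    and l: "l < min d1 d2"
  shows "s l \<le> s' l + e"
proof -
  let ?m = "min d1 d2"
  obtain c where c: "\<exists>j<Suc l. c j \<noteq> 0"
    "\<forall>i<l. (\<Sum>k<Suc l. ip d2 (\<lambda>j. V' j i) (\<lambda>j. V j k) * c k) = 0"
    using homogeneous_system[of l "Suc l" "\<lambda>i k. ip d2 (\<lambda>j. V' j i) (\<lambda>j. V j k)"] by blast
  define x where "x = (\<lambda>j. \<Sum>k\<in>{..<Suc l}. c k * V j k)"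
  have sub: "{..<Suc l} \<subseteq> {..<?m}" using l by auto
  note onV = is_svd_orthonormal(2)[OF svdA] and onU = is_svd_orthonormal(1)[OF svdA]
  have nx: "(vnorm d2 x)\<^sup>2 = (\<Sum>k<Suc l. (c k)\<^sup>2)"
    unfolding x_def by (rule vnorm_orthonormal_sum[OF orthonormal_mono[OF onV sub]]) simp
  obtain j where "j < Suc l" "c j \<noteq> 0" using c(1) by blast
  then have "(\<Sum>k<Suc l. (c k)\<^sup>2) > 0"
    by (intro sum_pos2[of _ j]) auto
  then have posx: "vnorm d2 x > 0" using nx by (metis vnorm_nonneg less_eq_real_def power_zero_numeral less_irrefl)
  have V'x: "ip d2 (\<lambda>j. V' j i) x = 0" if "i < l" for i
    using c(2) that unfolding x_def ip_sum_right ip_scale_right by (simp add: mult_ac)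
  have perpx: "perp d2 l V' x = x" by (simp add: perp_def V'x)
  have Vx: "ip d2 (\<lambda>j. V j k) x = (if k < Suc l then c k else 0)" if "k < ?m" for k
    unfolding x_def using ip_orthonormal_sum[OF onV finite_lessThan sub] that by simp
  have "(s l * vnorm d2 x)\<^sup>2 = (\<Sum>k<Suc l. (s l)\<^sup>2 * (c k)\<^sup>2)"
    by (simp add: power_mult_distrib nx sum_distrib_left del: sum.lessThan_Suc)
  also have "\<dots> \<le> (\<Sum>k<Suc l. (s k * c k)\<^sup>2)"
    unfolding power_mult_distrib
    using is_svd_decreasing[OF svdA _ l] is_svd_nonneg[OF svdA l]
    by (intro sum_mono mult_right_mono power_mono) auto
  also have "\<dots> = (\<Sum>k<?m. (s k * ip d2 (\<lambda>j. V j k) x)\<^sup>2)"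
    using sub by (intro sum.mono_neutral_cong_left) (auto simp: Vx)
  also have "\<dots> = (vnorm d1 (mv d2 A x))\<^sup>2"
  proof -
    have "vnorm d1 (mv d2 A x) = vnorm d1 (\<lambda>i. \<Sum>k<?m. s k * ip d2 (\<lambda>j. V j k) x * U i k)"
      by (rule vnorm_cong) (rule svd_mv[OF svdA])
    then show ?thesis
      using vnorm_orthonormal_sum[OF onU finite_lessThan, of "\<lambda>k. s k * ip d2 (\<lambda>j. V j k) x"] by simp
  qed
  finally have "s l * vnorm d2 x \<le> vnorm d1 (mv d2 A x)"
    by (rule power2_le_imp_le) simp
  also have "\<dots> = vnorm d1 (\<lambda>i. mv d2 M x i + mv d2 (\<lambda>i j. A i j - M i j) x i)"
    by (rule vnorm_cong) (simp add: mv_add[symmetric])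
  also have "\<dots> \<le> vnorm d1 (mv d2 M x) + e * vnorm d2 x"
    using E unfolding op_bounded_def by (intro order_trans[OF vnorm_triangle] add_left_mono) blast
  also have "vnorm d1 (mv d2 M x) \<le> s' l * vnorm d2 (perp d2 l V' x)"
  proof -
    have "vnorm d1 (mv d2 M x) = vnorm d1 (\<lambda>i. \<Sum>k\<in>{l..<?m}. s' k * ip d2 (\<lambda>j. V' j k) x * U' i k)"
      by (rule vnorm_cong) (auto simp: svd_mv[OF svdM] V'x intro!: sum.mono_neutral_cong_right)
    also have "\<dots> \<le> s' l * vnorm d2 (perp d2 l V' x)"
      using l is_svd_decreasing[OF svdM] is_svd_nonneg[OF svdM l]
      by (intro svd_tail_bound[OF svdM]) auto
    finally show ?thesis .
  qed
  finally have "s l * vnorm d2 x \<le> (s' l + e) * vnorm d2 x" by (simp add: perpx algebra_simps)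
  then show ?thesis using posx by simp
qed

text \<open>Weyl's inequality with error 0, used in both directions, shows that any two
  decompositions of a matrix have the same singular values, so the definite description
  denotes.\<close>

lemma sing_val_eq:
  assumes "is_svd d1 d2 A U V s" "1 \<le> k" "k \<le> min d1 d2"
  shows "sing_val d1 d2 A k = s (k - 1)"
proof -
  have 0: "op_bounded d1 d2 (\<lambda>i j. A i j - A i j) 0"
    by (simp add: op_bounded_def mv_def vnorm_def L2_set_def)
  have "s' (k - 1) = s (k - 1)" if "is_svd d1 d2 A U' V' s'" for U' V' s'
  proof -
    have "k - 1 < min d1 d2" using assms by linarith
    then show ?thesis using Weyl[OF that assms(1) 0] Weyl[OF assms(1) that 0] by fastforce
  qed
  then have "(THE x. \<exists>U V s. is_svd d1 d2 A U V s \<and> x = s (k - 1)) = s (k - 1)"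
    using assms(1) by (intro the_equality) blast+
  then show ?thesis using assms(2,3) by (simp add: sing_val_def)
qed


section \<open>Frobenius norm of the truncation error\<close>

lemma fro_norm_L2_set: "fro_norm d1 d2 M = L2_set (\<lambda>(i, j). M i j) ({..<d1} \<times> {..<d2})"
  by (simp add: fro_norm_def L2_set_def sum.cartesian_product case_prod_unfold)

lemma fro_norm_triangle:
  "fro_norm d1 d2 (\<lambda>i j. A i j + B i j) \<le> fro_norm d1 d2 A + fro_norm d1 d2 B"
  unfolding fro_norm_L2_set case_prod_unfold by (rule L2_set_triangle_ineq)

lemma fro_norm_cong:
  "(\<And>i j. i < d1 \<Longrightarrow> j < d2 \<Longrightarrow> M i j = N i j) \<Longrightarrow> fro_norm d1 d2 M = fro_norm d1 d2 N"
  by (simp add: fro_norm_def)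

lemma fro_norm_transpose: "fro_norm d2 d1 (\<lambda>i j. M j i) = fro_norm d1 d2 M"
  unfolding fro_norm_def by (subst sum.swap) simp

lemma fro_norm_nonneg [simp]: "0 \<le> fro_norm d1 d2 M"
  by (simp add: fro_norm_def sum_nonneg)

text \<open>Each row is a combination of orthonormal vectors, so its squared norm is the sum of its
  squared coefficients. This is where estimates for single vectors turn into a factor
  \<open>sqrt r\<close>.\<close>

lemma fro_norm_orthonormal_le:
  assumes "orthonormal d2 {..<r} V" and z: "\<And>l. l < r \<Longrightarrow> vnorm d1 (z l) \<le> b" and b: "0 \<le> b"
  shows "fro_norm d1 d2 (\<lambda>i j. \<Sum>l<r. z l i * V j l) \<le> sqrt (real r) * b"
proof (rule power2_le_imp_le)
  have "(fro_norm d1 d2 (\<lambda>i j. \<Sum>l<r. z l i * V j l))\<^sup>2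
      = (\<Sum>i<d1. \<Sum>j<d2. (\<Sum>l<r. z l i * V j l)\<^sup>2)"
    by (simp add: fro_norm_def sum_nonneg)
  also have "\<dots> = (\<Sum>i<d1. \<Sum>l<r. (z l i)\<^sup>2)"
    using vnorm_orthonormal_sum[OF assms(1) finite_lessThan] by (simp add: vnorm_power2)
  also have "\<dots> = (\<Sum>l<r. (vnorm d1 (z l))\<^sup>2)"
    unfolding vnorm_power2 by (rule sum.swap)
  also have "\<dots> \<le> (\<Sum>l<r. b\<^sup>2)"
    using z by (intro sum_mono power_mono) auto
  also have "\<dots> = (sqrt (real r) * b)\<^sup>2" by (simp add: power_mult_distrib)
  finally show "(fro_norm d1 d2 (\<lambda>i j. \<Sum>l<r. z l i * V j l))\<^sup>2 \<le> (sqrt (real r) * b)\<^sup>2" .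
qed (use b in simp)

text \<open>Here \<open>t\<close> stands for the singular value after the cut and \<open>g\<close>
  for the gap. The two pieces of the error add up to \<open>2 + 2 * e / g + 4 * t / g\<close>, and
  \<open>e \<le> g / 2\<close> brings the constant to 3.\<close>

lemma svd_truncation_perturbation:
  assumes svdA: "is_svd d1 d2 A U V s" and svdM: "is_svd d1 d2 M U' V' s'"
    and E: "op_bounded d1 d2 (\<lambda>i j. M i j - A i j) e" "0 \<le> e"
    and r: "1 \<le> r" "r \<le> min d1 d2"
    and tail: "\<And>k. r \<le> k \<Longrightarrow> k < min d1 d2 \<Longrightarrow> s k \<le> t" "0 \<le> t"
    and g: "0 < g" "t + g \<le> s (r - 1)" "e \<le> g / 2"
  shows "fro_norm d1 d2 (\<lambda>i j. (\<Sum>l<r. s' l * U' i l * V' j l) - (\<Sum>l<r. s l * U i l * V j l))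
    \<le> sqrt (real r) * e * (3 + 4 * t / g)"
proof -
  let ?m = "min d1 d2"
  note E' = E(1)[unfolded op_bounded_uminus[of d1 d2 M A]]
  have s_ge: "t + g \<le> s l" if "l < r" for l
    using is_svd_decreasing[OF svdA, of l "r - 1"] r that g(2) by linarith
  \<comment> \<open>Weyl costs at most \<open>e \<le> g / 2\<close>, so the leading values of either
    matrix stay at least \<open>g / 2\<close> above the tail of the other. Wedin's bound is thus
    available with the roles of \<open>A\<close> and \<open>M\<close> in both orders.\<close>
  have s'_ge: "t + g / 2 \<le> s' l" if "l < r" for l
  proof -
    have "s l \<le> s' l + e" using that r by (intro Weyl[OF svdA svdM E']) linarith
    then show ?thesis using s_ge[OF that] g by linarith
  qed
  have s'_tail: "s' k \<le> t + e" if "r \<le> k" "k < ?m" for k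
  proof -
    have "s' k \<le> s k + e" using that by (intro Weyl[OF svdM svdA E(1)])
    then show ?thesis using tail(1)[OF that] by linarith
  qed
  have te: "0 \<le> t + e" using tail(2) E(2) by simp
  \<comment> \<open>\<open>z l\<close> is the difference of the truncations applied to the
    \<open>l\<close>-th right vector of \<open>M\<close>. \<open>h l\<close> is minus the part of
    \<open>s l\<close> times the \<open>l\<close>-th right vector of \<open>A\<close> that lies off
    the leading right space of \<open>M\<close>; there the truncation of \<open>M\<close>
    vanishes.\<close>
  define z where "z l = (\<lambda>i. s' l * U' i l - (\<Sum>k<r. s k * ip d2 (\<lambda>j. V j k) (\<lambda>j. V' j l) * U i k))" for l
  define h where "h l = (\<lambda>j. - s l * perp d2 r V' (\<lambda>j. V j l) j)" for l
  have z_le: "vnorm d1 (z l) \<le> e + t * (e / (g / 2))" if l: "l < r" for l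
  proof -
    let ?v = "\<lambda>j. V' j l"
    have lm: "l < ?m" using l r by linarith
    have "z l i = mv d2 (\<lambda>i j. M i j - A i j) ?v i + (\<Sum>k\<in>{r..<?m}. s k * ip d2 (\<lambda>j. V j k) ?v * U i k)"
      if "i < d1" for i
    proof -
      have "mv d2 M ?v i = mv d2 A ?v i + mv d2 (\<lambda>i j. M i j - A i j) ?v i"
        by (subst mv_add[symmetric]) simp
      moreover have "mv d2 A ?v i = (\<Sum>k<r. s k * ip d2 (\<lambda>j. V j k) ?v * U i k)
          + (\<Sum>k\<in>{r..<?m}. s k * ip d2 (\<lambda>j. V j k) ?v * U i k)"
        unfolding svd_mv[OF svdA that] lessThan_atLeast0
        using r(2) by (intro sum.atLeastLessThan_concat[symmetric]) auto
      ultimately show ?thesis unfolding z_def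
        using svd_mv_right_vector[OF svdM that lm] by simp
    qed
    then have "vnorm d1 (z l) = vnorm d1 (\<lambda>i. mv d2 (\<lambda>i j. M i j - A i j) ?v i
        + (\<Sum>k\<in>{r..<?m}. s k * ip d2 (\<lambda>j. V j k) ?v * U i k))"
      by (rule vnorm_cong)
    also have "\<dots> \<le> vnorm d1 (mv d2 (\<lambda>i j. M i j - A i j) ?v)
        + vnorm d1 (\<lambda>i. \<Sum>k\<in>{r..<?m}. s k * ip d2 (\<lambda>j. V j k) ?v * U i k)"
      by (rule vnorm_triangle)
    also have "vnorm d1 (mv d2 (\<lambda>i j. M i j - A i j) ?v) \<le> e * vnorm d2 ?v"
      using E(1) by (simp add: op_bounded_def)
    also have "vnorm d2 ?v = 1"
      using vnorm_orthonormal[OF is_svd_orthonormal(2)[OF svdM]] lm by simp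
    also have "vnorm d1 (\<lambda>i. \<Sum>k\<in>{r..<?m}. s k * ip d2 (\<lambda>j. V j k) ?v * U i k)
        \<le> t * vnorm d2 (perp d2 r V ?v)"
      by (rule svd_tail_bound[OF svdA r(2) tail])
    also have "vnorm d2 (perp d2 r V ?v) \<le> e / (g / 2)"
      using s'_ge[OF l] g(1) by (intro Wedin_angle(2)[OF svdM svdA E r(2) l tail]) auto
    finally show ?thesis using tail(2) by (simp add: mult_left_mono)
  qed
  have h_le: "vnorm d2 (h l) \<le> (t + e) * (e / (g / 2)) + e" if l: "l < r" for l
  proof -
    have "vnorm d2 (h l) = s l * vnorm d2 (perp d2 r V' (\<lambda>j. V j l))"
      unfolding h_def vnorm_scale using s_ge[OF l] g tail(2) by simp
    \<comment> \<open>The possibly large \<open>s l\<close> is absorbed by Wedin's inequality in its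
      undivided form, so no ratio of \<open>s l\<close> to the gap arises; only \<open>t + e\<close>
      gets divided by it.\<close>
    also have "\<dots> \<le> (t + e) * vnorm d1 (perp d1 r U' (\<lambda>i. U i l)) + e"
      by (rule Wedin_right[OF svdA svdM E' E(2) r(2) l s'_tail te])
    also have "vnorm d1 (perp d1 r U' (\<lambda>i. U i l)) \<le> e / (g / 2)"
      using s_ge[OF l] g by (intro Wedin_angle(1)[OF svdA svdM E' E(2) r(2) l s'_tail te]) auto
    finally show ?thesis using te by (simp add: mult_left_mono)
  qed
  have sub: "{..<r} \<subseteq> {..<?m}" using r by auto
  have split: "(\<Sum>l<r. s' l * U' i l * V' j l) - (\<Sum>l<r. s l * U i l * V j l)
      = (\<Sum>l<r. z l i * V' j l) + (\<Sum>l<r. h l j * U i l)" for i j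
  proof -
    have "(\<Sum>l<r. z l i * V' j l) = (\<Sum>l<r. s' l * U' i l * V' j l)
        - (\<Sum>l<r. \<Sum>k<r. s k * ip d2 (\<lambda>j. V j k) (\<lambda>j. V' j l) * U i k * V' j l)"
      by (simp add: z_def left_diff_distrib sum_subtractf sum_distrib_right)
    moreover have "(\<Sum>l<r. h l j * U i l) = (\<Sum>k<r. \<Sum>l<r. s k * ip d2 (\<lambda>j. V j k) (\<lambda>j. V' j l) * U i k * V' j l)
        - (\<Sum>l<r. s l * U i l * V j l)"
      by (simp add: h_def perp_def algebra_simps sum_subtractf sum_distrib_left sum_distrib_right sum_negf
          ip_commute[of d2 "\<lambda>j. V' j _"])
    ultimately show ?thesis
      using sum.swap[of "\<lambda>l k. s k * ip d2 (\<lambda>j. V j k) (\<lambda>j. V' j l) * U i k * V' j l" "{..<r}" "{..<r}"]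
      by simp
  qed
  have "fro_norm d1 d2 (\<lambda>i j. (\<Sum>l<r. s' l * U' i l * V' j l) - (\<Sum>l<r. s l * U i l * V j l))
      \<le> fro_norm d1 d2 (\<lambda>i j. \<Sum>l<r. z l i * V' j l) + fro_norm d1 d2 (\<lambda>i j. \<Sum>l<r. h l j * U i l)"
    unfolding split by (rule fro_norm_triangle)
  also have "fro_norm d1 d2 (\<lambda>i j. \<Sum>l<r. z l i * V' j l) \<le> sqrt (real r) * (e + t * (e / (g / 2)))"
    using z_le E(2) tail(2) g(1)
    by (intro fro_norm_orthonormal_le[OF orthonormal_mono[OF is_svd_orthonormal(2)[OF svdM] sub]]) auto
  also have "fro_norm d1 d2 (\<lambda>i j. \<Sum>l<r. h l j * U i l) = fro_norm d2 d1 (\<lambda>j i. \<Sum>l<r. h l j * U i l)"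
    by (rule fro_norm_transpose[symmetric])
  also have "\<dots> \<le> sqrt (real r) * ((t + e) * (e / (g / 2)) + e)"
    using h_le E(2) te g(1)
    by (intro fro_norm_orthonormal_le[OF orthonormal_mono[OF is_svd_orthonormal(1)[OF svdA] sub]]) auto
  finally have "fro_norm d1 d2 (\<lambda>i j. (\<Sum>l<r. s' l * U' i l * V' j l) - (\<Sum>l<r. s l * U i l * V j l))
      \<le> sqrt (real r) * (e + t * (e / (g / 2))) + sqrt (real r) * ((t + e) * (e / (g / 2)) + e)"
    by simp
  also have "\<dots> = sqrt (real r) * e * (2 + 2 * e / g + 4 * t / g)"
    using g(1) by (simp add: field_simps)
  also have "\<dots> \<le> sqrt (real r) * e * (3 + 4 * t / g)"
    using g E(2) by (intro mult_left_mono) (auto simp: field_simps)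
  finally show ?thesis .
qed

section \<open>Trace powers and closed walks\<close>

text \<open>Walks of length \<open>2 * k\<close> in the complete bipartite graph, through row
  \<open>I t\<close>, column \<open>J t\<close>, row \<open>I (Suc t)\<close>. The starting row is
  stored twice, as \<open>I 0\<close> and \<open>I k\<close>, so that walks can be lengthened
  without indices modulo \<open>k\<close>.\<close>

definition closed_walks :: "nat \<Rightarrow> nat \<Rightarrow> nat \<Rightarrow> ((nat \<Rightarrow> nat) \<times> (nat \<Rightarrow> nat)) set" where
  "closed_walks d1 d2 k = {(I, J). I \<in> {..k} \<rightarrow>\<^sub>E {..<d1} \<and> J \<in> {..<k} \<rightarrow>\<^sub>E {..<d2} \<and> I 0 = I k}"

definition walk_prod :: "nat \<Rightarrow> (nat \<Rightarrow> nat \<Rightarrow> real) \<Rightarrow> (nat \<Rightarrow> nat) \<Rightarrow> (nat \<Rightarrow> nat) \<Rightarrow> real" where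
  "walk_prod k M I J = (\<Prod>t<k. M (I t) (J t) * M (I (Suc t)) (J t))"

text \<open>The trace of \<open>(M M\<^sup>T)\<^sup>k\<close>, expanded.\<close>

definition trace_pow :: "nat \<Rightarrow> nat \<Rightarrow> nat \<Rightarrow> (nat \<Rightarrow> nat \<Rightarrow> real) \<Rightarrow> real" where
  "trace_pow d1 d2 k M = (\<Sum>(I, J)\<in>closed_walks d1 d2 k. walk_prod k M I J)"

definition gram :: "nat \<Rightarrow> (nat \<Rightarrow> nat \<Rightarrow> real) \<Rightarrow> nat \<Rightarrow> nat \<Rightarrow> real" where
  "gram d2 M i j = (\<Sum>l<d2. M i l * M j l)"

primrec gram_pow :: "nat \<Rightarrow> nat \<Rightarrow> (nat \<Rightarrow> nat \<Rightarrow> real) \<Rightarrow> nat \<Rightarrow> nat \<Rightarrow> nat \<Rightarrow> real" where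
  "gram_pow d1 d2 M 0 = (\<lambda>i j. if i = j then 1 else 0)"
| "gram_pow d1 d2 M (Suc k) = (\<lambda>i j. \<Sum>a<d1. gram_pow d1 d2 M k i a * gram d2 M a j)"

lemma sum_PiE_insert:
  assumes "x \<notin> S"
  shows "(\<Sum>f\<in>PiE (insert x S) A. g f) = (\<Sum>f\<in>PiE S A. \<Sum>a\<in>A x. g (f(x := a)))"
proof -
  have inj: "inj_on (\<lambda>(y, f). f(x := y)) (A x \<times> PiE S A)"
    using inj_combinator[OF assms] .
  have "(\<Sum>f\<in>PiE (insert x S) A. g f) = (\<Sum>(a, f)\<in>A x \<times> PiE S A. g (f(x := a)))"
    unfolding PiE_insert_eq by (subst sum.reindex[OF inj]) (simp add: case_prod_unfold)
  also have "\<dots> = (\<Sum>f\<in>PiE S A. \<Sum>a\<in>A x. g (f(x := a)))"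
    by (subst sum.cartesian_product[symmetric], rule sum.swap)
  finally show ?thesis .
qed

text \<open>Free endpoints make the induction work: a further factor appends one column and one row
  to the walk.\<close>

lemma gram_pow_walks:
  assumes "i < d1" "j < d1"
  shows "gram_pow d1 d2 M k i j = (\<Sum>I\<in>{..k} \<rightarrow>\<^sub>E {..<d1}. \<Sum>J\<in>{..<k} \<rightarrow>\<^sub>E {..<d2}.
    if I 0 = i \<and> I k = j then walk_prod k M I J else 0)"
  using assms(2)
proof (induction k arbitrary: j)
  case 0
  have "(\<Sum>I\<in>{..0::nat} \<rightarrow>\<^sub>E {..<d1}. if I 0 = i \<and> I 0 = j then 1 else 0) = (if i = j then 1 else (0::real))"
  proof -
    have "{..0::nat} = insert 0 {}" by auto
    then have "(\<Sum>I\<in>{..0::nat} \<rightarrow>\<^sub>E {..<d1}. if I 0 = i \<and> I 0 = j then 1 else 0)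
       = (\<Sum>a<d1. if a = i \<and> a = j then 1 else (0::real))"
      by (simp add: sum_PiE_insert)
    also have "\<dots> = (\<Sum>a<d1. if a = i then (if i = j then 1 else 0) else (0::real))"
      by (intro sum.cong) auto
    finally show ?thesis using assms(1) by simp
  qed
  moreover have "(\<Sum>I\<in>{..0} \<rightarrow>\<^sub>E {..<d1}. \<Sum>J\<in>{..<0} \<rightarrow>\<^sub>E {..<d2}. if I 0 = i \<and> I 0 = j then walk_prod 0 M I J else 0)
      = (\<Sum>I\<in>{..0::nat} \<rightarrow>\<^sub>E {..<d1}. if I 0 = i \<and> I 0 = j then 1 else 0)"
    unfolding lessThan_0 PiE_empty_domain walk_prod_def by (simp cong: if_cong)
  ultimately show ?case by (simp del: atMost_0)
next
  case (Suc k)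
  let ?P = "{..k} \<rightarrow>\<^sub>E {..<d1}" and ?Q = "{..<k} \<rightarrow>\<^sub>E {..<d2}"
  have "gram_pow d1 d2 M (Suc k) i j
      = (\<Sum>a<d1. (\<Sum>I\<in>?P. \<Sum>J\<in>?Q. if I 0 = i \<and> I k = a then walk_prod k M I J else 0) * gram d2 M a j)"
    using Suc.IH by simp
  also have "\<dots> = (\<Sum>I\<in>?P. \<Sum>J\<in>?Q. \<Sum>a<d1.
      if a = I k then (if I 0 = i then walk_prod k M I J * gram d2 M (I k) j else 0) else 0)"
    unfolding sum_distrib_right
    by (subst sum.swap, rule sum.cong[OF refl], subst sum.swap, intro sum.cong refl) auto
  also have "\<dots> = (\<Sum>I\<in>?P. \<Sum>J\<in>?Q. if I 0 = i then walk_prod k M I J * gram d2 M (I k) j else 0)"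
    by (intro sum.cong refl) (auto simp: PiE_iff)
  also have "\<dots> = (\<Sum>I\<in>?P. \<Sum>J\<in>?Q. \<Sum>b<d1. if b = j then (\<Sum>c<d2. 
       if I 0 = i then walk_prod k M I J * (M (I k) c * M b c) else 0) else 0)"
    using Suc.prems by (simp add: gram_def sum_distrib_left if_distrib[of "sum _"] cong: if_cong)
       (intro sum.cong refl, auto)
  also have "\<dots> = (\<Sum>I\<in>?P. \<Sum>b<d1. \<Sum>J\<in>?Q. \<Sum>c<d2. 
       if I 0 = i \<and> b = j then walk_prod k M I J * (M (I k) c * M b c) else 0)"
    by (rule sum.cong[OF refl], subst sum.swap, intro sum.cong refl) auto
  also have "\<dots> = (\<Sum>I\<in>?P. \<Sum>b<d1. \<Sum>J\<in>?Q. \<Sum>c<d2.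
      if (I(Suc k := b)) 0 = i \<and> (I(Suc k := b)) (Suc k) = j
      then walk_prod (Suc k) M (I(Suc k := b)) (J(k := c)) else 0)"
    by (intro sum.cong refl) (simp add: walk_prod_def)
  also have "\<dots> = (\<Sum>I\<in>{..Suc k} \<rightarrow>\<^sub>E {..<d1}. \<Sum>J\<in>{..<Suc k} \<rightarrow>\<^sub>E {..<d2}.
      if I 0 = i \<and> I (Suc k) = j then walk_prod (Suc k) M I J else 0)"
    unfolding atMost_Suc lessThan_Suc by (subst sum_PiE_insert, simp)+ simp
  finally show ?case .
qed

lemma finite_closed_walks: "finite (closed_walks d1 d2 k)"
  by (rule finite_subset[of _ "({..k} \<rightarrow>\<^sub>E {..<d1}) \<times> ({..<k} \<rightarrow>\<^sub>E {..<d2})"])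
    (auto simp: closed_walks_def intro!: finite_PiE)

lemma trace_pow_gram: "trace_pow d1 d2 k M = (\<Sum>i<d1. gram_pow d1 d2 M k i i)"
proof -
  let ?P = "{..k} \<rightarrow>\<^sub>E {..<d1}" and ?Q = "{..<k} \<rightarrow>\<^sub>E {..<d2}"
  have "(\<Sum>i<d1. gram_pow d1 d2 M k i i)
      = (\<Sum>i<d1. \<Sum>I\<in>?P. \<Sum>J\<in>?Q. if I 0 = i \<and> I k = i then walk_prod k M I J else 0)"
    by (intro sum.cong refl gram_pow_walks) auto
  also have "\<dots> = (\<Sum>I\<in>?P. \<Sum>J\<in>?Q. \<Sum>i<d1. if i = I 0 then (if I 0 = I k then walk_prod k M I J else 0) else 0)"
    by (subst sum.swap, rule sum.cong[OF refl], subst sum.swap, intro sum.cong refl) auto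
  also have "\<dots> = (\<Sum>I\<in>?P. \<Sum>J\<in>?Q. if I 0 = I k then walk_prod k M I J else 0)"
    by (intro sum.cong refl) (auto simp: PiE_iff)
  also have "\<dots> = (\<Sum>(I, J)\<in>?P \<times> ?Q. if I 0 = I k then walk_prod k M I J else 0)"
    by (rule sum.cartesian_product)
  also have "\<dots> = trace_pow d1 d2 k M"
    unfolding trace_pow_def
    by (rule sum.mono_neutral_cong_right) (auto simp: closed_walks_def intro!: finite_PiE)
  finally show ?thesis by simp
qed

section \<open>Comparing trace powers with the spectral norm\<close>

definition gram_map :: "nat \<Rightarrow> nat \<Rightarrow> (nat \<Rightarrow> nat \<Rightarrow> real) \<Rightarrow> (nat \<Rightarrow> real) \<Rightarrow> nat \<Rightarrow> real" where
  "gram_map d1 d2 M x = mv d2 M (mv d1 (\<lambda>i j. M j i) x)"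

lemma mv_cong: "(\<And>j. j < d \<Longrightarrow> x j = y j) \<Longrightarrow> mv d M x i = mv d M y i"
  by (simp add: mv_def)

lemma gram_map_gram: "gram_map d1 d2 M x i = mv d1 (gram d2 M) x i"
  unfolding gram_map_def mv_def gram_def sum_distrib_left sum_distrib_right
  by (subst sum.swap) (simp add: mult_ac)

lemma mv_gram_pow: "i < d1 \<Longrightarrow> mv d1 (gram_pow d1 d2 M k) x i = (gram_map d1 d2 M ^^ k) x i"
proof (induction k arbitrary: x)
  case 0
  have "mv d1 (gram_pow d1 d2 M 0) x i = (\<Sum>j<d1. if i = j then x j else 0)"
    unfolding mv_def by (rule sum.cong) auto
  then show ?case using 0 by simp
next
  case (Suc k)
  have "mv d1 (gram_pow d1 d2 M (Suc k)) x i = mv d1 (gram_pow d1 d2 M k) (mv d1 (gram d2 M) x) i"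
    unfolding mv_def gram_pow.simps sum_distrib_left sum_distrib_right
    by (subst sum.swap) (simp add: mult_ac)
  also have "\<dots> = mv d1 (gram_pow d1 d2 M k) (gram_map d1 d2 M x) i"
    by (rule mv_cong) (simp add: gram_map_gram)
  finally show ?case using Suc by (simp add: funpow_Suc_right del: funpow.simps)
qed

lemma ip_gram_map: "ip d1 x (gram_map d1 d2 M y) = ip d1 (gram_map d1 d2 M x) y"
  unfolding gram_map_def ip_mv ..

lemma ip_gram_map_pow: "ip d1 x ((gram_map d1 d2 M ^^ k) y) = ip d1 ((gram_map d1 d2 M ^^ k) x) y"
proof (induction k arbitrary: x)
  case (Suc k)
  have "ip d1 x ((gram_map d1 d2 M ^^ Suc k) y) = ip d1 ((gram_map d1 d2 M ^^ k) (gram_map d1 d2 M x)) y"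
    by (simp add: ip_gram_map Suc)
  then show ?case by (simp add: funpow_Suc_right del: funpow.simps)
qed simp

lemma vnorm_gram_map_pow:
  "(vnorm d1 ((gram_map d1 d2 M ^^ k) x))\<^sup>2 = ip d1 x ((gram_map d1 d2 M ^^ (2 * k)) x)"
  by (simp add: vnorm_power2_ip mult_2 funpow_add ip_gram_map_pow)

text \<open>Symmetry and Cauchy-Schwarz double the exponent in each step, which avoids
  diagonalisation. It is the reason for choosing \<open>k\<close> as a power of two.\<close>

lemma gram_map_pow_lower:
  assumes "vnorm d1 x \<le> 1"
  shows "vnorm d1 (gram_map d1 d2 M x) ^ (2 ^ m) \<le> vnorm d1 ((gram_map d1 d2 M ^^ (2 ^ m)) x)"
proof (induction m)
  case (Suc m)
  let ?S = "gram_map d1 d2 M"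
  have "vnorm d1 (?S x) ^ (2 ^ Suc m) = (vnorm d1 (?S x) ^ (2 ^ m))\<^sup>2"
    by (simp add: power_mult[symmetric] mult.commute)
  also have "\<dots> \<le> (vnorm d1 ((?S ^^ (2 ^ m)) x))\<^sup>2"
    by (intro power_mono Suc) auto
  also have "\<dots> = ip d1 x ((?S ^^ (2 ^ Suc m)) x)"
    unfolding vnorm_gram_map_pow by simp
  also have "\<dots> \<le> vnorm d1 x * vnorm d1 ((?S ^^ (2 ^ Suc m)) x)"
    using ip_Cauchy_Schwarz abs_le_D1 by blast
  also have "\<dots> \<le> vnorm d1 ((?S ^^ (2 ^ Suc m)) x)"
    using mult_right_mono[OF assms vnorm_nonneg] by simp
  finally show ?case .
qed simp

definition unit_vec :: "nat \<Rightarrow> nat \<Rightarrow> real" where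
  "unit_vec i j = (if i = j then 1 else 0)"

lemma ip_unit_vec: "i < d \<Longrightarrow> ip d (unit_vec i) x = x i"
proof -
  assume "i < d"
  moreover have "ip d (unit_vec i) x = (\<Sum>j<d. if i = j then x j else 0)"
    unfolding ip_def unit_vec_def by (rule sum.cong) auto
  ultimately show ?thesis by simp
qed

lemma vnorm_unit_vec: "i < d \<Longrightarrow> vnorm d (unit_vec i) = 1"
  using vnorm_power2_ip[of d "unit_vec i"] ip_unit_vec[of i d "unit_vec i"] vnorm_nonneg[of d "unit_vec i"]
  by (simp add: unit_vec_def power2_eq_1_iff)

lemma mv_unit_vec: "j < d \<Longrightarrow> mv d M (unit_vec j) i = M i j"
  by (simp add: mv_ip ip_commute[of d _ "unit_vec j"] ip_unit_vec)

lemma vnorm_mv_le: "(vnorm d1 (mv d2 G x))\<^sup>2 \<le> (\<Sum>j<d2. (vnorm d1 (\<lambda>i. G i j))\<^sup>2) * (vnorm d2 x)\<^sup>2"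
proof -
  have "(vnorm d1 (mv d2 G x))\<^sup>2 = (\<Sum>i<d1. (ip d2 (G i) x)\<^sup>2)"
    by (simp add: vnorm_power2 mv_ip)
  also have "\<dots> \<le> (\<Sum>i<d1. (vnorm d2 (G i) * vnorm d2 x)\<^sup>2)"
    by (intro sum_mono abs_le_square_iff[THEN iffD1]) (auto intro: order_trans[OF ip_Cauchy_Schwarz])
  also have "\<dots> = (\<Sum>i<d1. \<Sum>j<d2. (G i j)\<^sup>2) * (vnorm d2 x)\<^sup>2"
    by (simp add: power_mult_distrib vnorm_power2[of d2 "G _"] sum_distrib_right)
  also have "(\<Sum>i<d1. \<Sum>j<d2. (G i j)\<^sup>2) = (\<Sum>j<d2. (vnorm d1 (\<lambda>i. G i j))\<^sup>2)"
    unfolding vnorm_power2 by (rule sum.swap)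
  finally show ?thesis .
qed

text \<open>The Gram matrix is symmetric, so the trace of an even power is a squared Frobenius norm.
  Besides its use for the norm estimate, this gives the nonnegativity needed in Markov's
  inequality.\<close>

lemma trace_pow_double:
  "trace_pow d1 d2 (2 * k) M = (\<Sum>j<d1. (vnorm d1 (\<lambda>i. gram_pow d1 d2 M k i j))\<^sup>2)"
  unfolding trace_pow_gram
proof (rule sum.cong[OF refl])
  fix j assume "j \<in> {..<d1}"
  then have j: "j < d1" by simp
  have "vnorm d1 (\<lambda>i. gram_pow d1 d2 M k i j) = vnorm d1 ((gram_map d1 d2 M ^^ k) (unit_vec j))"
    by (rule vnorm_cong) (simp add: mv_gram_pow[symmetric] mv_unit_vec j)
  then show "gram_pow d1 d2 M (2 * k) j j = (vnorm d1 (\<lambda>i. gram_pow d1 d2 M k i j))\<^sup>2"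
    using j by (simp add: vnorm_gram_map_pow ip_unit_vec mv_gram_pow[symmetric] mv_unit_vec)
qed

lemma op_bounded_unit:
  assumes unit: "\<And>x. vnorm d2 x \<le> 1 \<Longrightarrow> vnorm d1 (mv d2 M x) \<le> c"
  shows "op_bounded d1 d2 M c"
  unfolding op_bounded_def
proof
  fix x
  show "vnorm d1 (mv d2 M x) \<le> c * vnorm d2 x"
  proof (cases "vnorm d2 x = 0")
    case True
    then have "\<forall>i<d2. x i = 0" by (simp add: vnorm_def L2_set_eq_0_iff)
    then have "vnorm d1 (mv d2 M x) = vnorm d1 (\<lambda>i. 0)" by (intro vnorm_cong) (simp add: mv_def)
    then show ?thesis using True by (simp add: vnorm_def L2_set_def)
  next
    case False
    then have p: "vnorm d2 x > 0" by (simp add: order_less_le)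
    have "vnorm d1 (mv d2 M (\<lambda>i. inverse (vnorm d2 x) * x i)) \<le> c"
      by (rule unit) (use p in \<open>simp add: vnorm_scale\<close>)
    moreover have "mv d2 M (\<lambda>i. inverse (vnorm d2 x) * x i) = (\<lambda>j. inverse (vnorm d2 x) * mv d2 M x j)"
      by (simp add: mv_def sum_distrib_left mult_ac)
    ultimately have "inverse (vnorm d2 x) * vnorm d1 (mv d2 M x) \<le> c"
      using p by (simp add: vnorm_scale)
    then show ?thesis using p by (simp add: field_simps)
  qed
qed

text \<open>Let S = M M^T and let \<open>x\<close> have norm at most 1. The square of the norm of
  M^T x is at most the norm of S x; its \<open>2 ^ m\<close>-th power is at most the norm of the
  \<open>2 ^ m\<close>-th iterate of S at \<open>x\<close>, hence at most the Frobenius norm of that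
  power of S, whose square is the trace.\<close>

lemma op_bounded_of_trace_pow:
  assumes T: "trace_pow d1 d2 (2 ^ Suc m) M \<le> c ^ (2 * 2 ^ Suc m)" and c: "0 \<le> c"
  shows "op_bounded d1 d2 M c"
proof -
  let ?S = "gram_map d1 d2 M" let ?N = "mv d1 (\<lambda>i j. M j i)" let ?k = "2 ^ m :: nat"
  have unit: "vnorm d2 (?N x) \<le> c" if x: "vnorm d1 x \<le> 1" for x
  proof -
    have "(vnorm d2 (?N x))\<^sup>2 = ip d1 x (?S x)"
      by (simp add: vnorm_power2_ip gram_map_def ip_mv)
    also have "\<dots> \<le> vnorm d1 x * vnorm d1 (?S x)"
      using ip_Cauchy_Schwarz abs_le_D1 by blast
    also have "\<dots> \<le> vnorm d1 (?S x)"
      using mult_right_mono[OF x vnorm_nonneg] by simp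
    finally have "((vnorm d2 (?N x))\<^sup>2) ^ ?k \<le> vnorm d1 (?S x) ^ ?k"
      by (rule power_mono) simp
    also have "\<dots> \<le> vnorm d1 ((?S ^^ ?k) x)"
      by (rule gram_map_pow_lower[OF x])
    also have "\<dots> = vnorm d1 (mv d1 (gram_pow d1 d2 M ?k) x)"
      by (rule vnorm_cong) (simp add: mv_gram_pow)
    finally have "(((vnorm d2 (?N x))\<^sup>2) ^ ?k)\<^sup>2 \<le> (vnorm d1 (mv d1 (gram_pow d1 d2 M ?k) x))\<^sup>2"
      by (rule power_mono) simp
    also have "\<dots> \<le> (\<Sum>j<d1. (vnorm d1 (\<lambda>i. gram_pow d1 d2 M ?k i j))\<^sup>2) * (vnorm d1 x)\<^sup>2"
      by (rule vnorm_mv_le)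
    also have "\<dots> \<le> (\<Sum>j<d1. (vnorm d1 (\<lambda>i. gram_pow d1 d2 M ?k i j))\<^sup>2) * 1"
      using x by (intro mult_left_mono sum_nonneg power_le_one) auto
    also have "\<dots> \<le> c ^ (2 * 2 ^ Suc m)"
      using T trace_pow_double[of d1 d2 ?k M] by simp
    finally have "vnorm d2 (?N x) ^ (2 * 2 ^ Suc m) \<le> c ^ (2 * 2 ^ Suc m)"
      by (simp add: power_mult[symmetric] mult_ac)
    then show ?thesis using c by (simp add: power_mono_iff)
  qed
  then have "op_bounded d2 d1 (\<lambda>i j. M j i) c" by (rule op_bounded_unit)
  then show ?thesis using op_bounded_transpose[OF _ c] by force
qed

lemma trace_pow_le_op_bounded:
  assumes "op_bounded d1 d2 M c" "0 \<le> c"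
  shows "trace_pow d1 d2 k M \<le> real d1 * c ^ (2 * k)"
proof -
  let ?S = "gram_map d1 d2 M"
  have S: "vnorm d1 ((?S ^^ k) x) \<le> c ^ (2 * k) * vnorm d1 x" for x k
  proof (induction k)
    case (Suc k)
    have "vnorm d1 ((?S ^^ Suc k) x) \<le> c * (c * vnorm d1 ((?S ^^ k) x))"
    proof -
      have "vnorm d1 (?S y) \<le> c * vnorm d2 (mv d1 (\<lambda>i j. M j i) y)" for y
        using assms by (simp add: gram_map_def op_bounded_def)
      also have "\<dots> y \<le> c * (c * vnorm d1 y)" for y
        using op_bounded_transpose[OF assms] assms(2)
        by (intro mult_left_mono) (simp_all add: op_bounded_def)
      finally show ?thesis by simp
    qed
    also have "\<dots> \<le> c * (c * (c ^ (2 * k) * vnorm d1 x))"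
      by (intro mult_left_mono Suc assms)
    finally show ?case by (simp add: mult_ac)
  qed simp
  have "gram_pow d1 d2 M k i i \<le> c ^ (2 * k)" if i: "i < d1" for i
  proof -
    have "gram_pow d1 d2 M k i i = ip d1 (unit_vec i) ((?S ^^ k) (unit_vec i))"
      using i by (simp add: ip_unit_vec mv_gram_pow[symmetric] mv_unit_vec)
    also have "\<dots> \<le> vnorm d1 (unit_vec i) * vnorm d1 ((?S ^^ k) (unit_vec i))"
      using ip_Cauchy_Schwarz abs_le_D1 by blast
    also have "\<dots> \<le> c ^ (2 * k)" using S[of k "unit_vec i"] i by (simp add: vnorm_unit_vec)
    finally show ?thesis .
  qed
  then have "trace_pow d1 d2 k M \<le> (\<Sum>i<d1. c ^ (2 * k))"
    unfolding trace_pow_gram by (intro sum_mono) auto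
  then show ?thesis by simp
qed

section \<open>Expected trace powers of random matrices\<close>

lemma expectation_prod_Pi_pmf_finite:
  fixes f :: "'a \<Rightarrow> 'b \<Rightarrow> real"
  assumes "finite A" "\<And>x. x \<in> A \<Longrightarrow> finite (set_pmf (p x))"
  shows "measure_pmf.expectation (Pi_pmf A dflt p) (\<lambda>y. \<Prod>x\<in>A. f x (y x))
       = (\<Prod>x\<in>A. measure_pmf.expectation (p x) (f x))"
  using assms
proof (induction A)
  case (insert a A)
  have fin: "finite (set_pmf (Pi_pmf A dflt p))"
    using insert by (simp add: set_Pi_pmf finite_PiE_dflt)
  have fin': "finite (set_pmf (p a))" using insert by simp
  let ?g = "\<lambda>y. \<Prod>x\<in>A. f x (y x)"
  have "measure_pmf.expectation (Pi_pmf (insert a A) dflt p) (\<lambda>y. \<Prod>x\<in>insert a A. f x (y x))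
      = measure_pmf.expectation (pair_pmf (p a) (Pi_pmf A dflt p)) (\<lambda>(v, y). f a v * ?g y)"
    unfolding Pi_pmf_insert[OF insert.hyps] integral_map_pmf
    using insert.hyps by (intro Bochner_Integration.integral_cong refl)
      (auto intro!: prod.cong arg_cong2[of _ _ _ _ "(*)"])
  also have "\<dots> = (\<Sum>(v, y)\<in>set_pmf (p a) \<times> set_pmf (Pi_pmf A dflt p).
      (f a v * ?g y) * (pmf (p a) v * pmf (Pi_pmf A dflt p) y))"
    by (subst integral_measure_pmf_real[of "set_pmf (p a) \<times> set_pmf (Pi_pmf A dflt p)"])
      (auto simp: fin fin' pmf_pair case_prod_unfold intro!: sum.cong)
  also have "\<dots> = (\<Sum>v\<in>set_pmf (p a). f a v * pmf (p a) v)
      * (\<Sum>y\<in>set_pmf (Pi_pmf A dflt p). ?g y * pmf (Pi_pmf A dflt p) y)"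
    by (simp add: sum_product sum.cartesian_product mult_ac)
  also have "(\<Sum>v\<in>set_pmf (p a). f a v * pmf (p a) v) = measure_pmf.expectation (p a) (f a)"
    by (subst integral_measure_pmf_real[OF fin']) auto
  also have "(\<Sum>y\<in>set_pmf (Pi_pmf A dflt p). ?g y * pmf (Pi_pmf A dflt p) y)
      = measure_pmf.expectation (Pi_pmf A dflt p) ?g"
    by (subst integral_measure_pmf_real[OF fin]) auto
  also have "\<dots> = (\<Prod>x\<in>A. measure_pmf.expectation (p x) (f x))"
    using insert by simp
  finally show ?case using insert.hyps by simp
qed simp

section \<open>Moments of walk products\<close>

text \<open>The Boolean is the direction: \<open>False\<close> goes from row \<open>I t\<close> to
  column \<open>J t\<close>, \<open>True\<close> from there on to row
  \<open>I (Suc t)\<close>.\<close>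

definition walk_steps :: "nat \<Rightarrow> (nat \<times> bool) set" where
  "walk_steps k = {..<k} \<times> UNIV"

definition walk_edge :: "(nat \<Rightarrow> nat) \<Rightarrow> (nat \<Rightarrow> nat) \<Rightarrow> nat \<times> bool \<Rightarrow> nat \<times> nat" where
  "walk_edge I J = (\<lambda>(t, b). (I (if b then Suc t else t), J t))"

definition edge_mult :: "nat \<Rightarrow> (nat \<Rightarrow> nat) \<Rightarrow> (nat \<Rightarrow> nat) \<Rightarrow> nat \<times> nat \<Rightarrow> nat" where
  "edge_mult k I J e = card {s \<in> walk_steps k. walk_edge I J s = e}"

definition walk_edges :: "nat \<Rightarrow> (nat \<Rightarrow> nat) \<Rightarrow> (nat \<Rightarrow> nat) \<Rightarrow> (nat \<times> nat) set" where
  "walk_edges k I J = walk_edge I J ` walk_steps k"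

definition no_simple_edge :: "nat \<Rightarrow> (nat \<Rightarrow> nat) \<Rightarrow> (nat \<Rightarrow> nat) \<Rightarrow> bool" where
  "no_simple_edge k I J \<longleftrightarrow> (\<forall>s\<in>walk_steps k. 2 \<le> edge_mult k I J (walk_edge I J s))"

lemma finite_walk_steps [simp]: "finite (walk_steps k)"
  by (simp add: walk_steps_def)

lemma finite_walk_edges [simp]: "finite (walk_edges k I J)"
  by (simp add: walk_edges_def)

lemma walk_prod_edges:
  "walk_prod k M I J = (\<Prod>e\<in>walk_edges k I J. (case e of (i, j) \<Rightarrow> M i j) ^ edge_mult k I J e)"
proof -
  let ?m = "\<lambda>(i, j). M i j"
  have "walk_prod k M I J = (\<Prod>t<k. \<Prod>b\<in>UNIV. ?m (walk_edge I J (t, b)))"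
    by (simp add: walk_prod_def walk_edge_def UNIV_bool mult.commute)
  also have "\<dots> = (\<Prod>s\<in>walk_steps k. ?m (walk_edge I J s))"
    unfolding walk_steps_def by (subst prod.cartesian_product) (simp add: case_prod_unfold)
  also have "\<dots> = (\<Prod>e\<in>walk_edges k I J. \<Prod>s\<in>{s \<in> walk_steps k. walk_edge I J s = e}. ?m (walk_edge I J s))"
    unfolding walk_edges_def by (rule prod.image_gen) simp
  also have "\<dots> = (\<Prod>e\<in>walk_edges k I J. ?m e ^ edge_mult k I J e)"
    by (intro prod.cong refl) (simp add: edge_mult_def)
  finally show ?thesis .
qed

lemma expectation_walk_prod:
  fixes x :: "nat \<times> nat \<Rightarrow> 'b \<Rightarrow> real"
  assumes D: "finite D" "walk_edges k I J \<subseteq> D" and p: "\<And>e. e \<in> D \<Longrightarrow> finite (set_pmf (p e))"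
  shows "measure_pmf.expectation (Pi_pmf D dflt p) (\<lambda>\<omega>. walk_prod k (\<lambda>i j. x (i, j) (\<omega> (i, j))) I J)
       = (\<Prod>e\<in>walk_edges k I J. measure_pmf.expectation (p e) (\<lambda>b. x e b ^ edge_mult k I J e))"
proof -
  let ?f = "\<lambda>e b. if e \<in> walk_edges k I J then x e b ^ edge_mult k I J e else 1"
  have "walk_prod k (\<lambda>i j. x (i, j) (\<omega> (i, j))) I J = (\<Prod>e\<in>D. ?f e (\<omega> e))" for \<omega>
    unfolding walk_prod_edges using D by (intro prod.mono_neutral_cong_left) auto
  then have "measure_pmf.expectation (Pi_pmf D dflt p) (\<lambda>\<omega>. walk_prod k (\<lambda>i j. x (i, j) (\<omega> (i, j))) I J)
      = (\<Prod>e\<in>D. measure_pmf.expectation (p e) (?f e))"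
    using expectation_prod_Pi_pmf_finite[OF D(1) p, where f = ?f] by simp
  also have "\<dots> = (\<Prod>e\<in>walk_edges k I J. measure_pmf.expectation (p e) (\<lambda>b. x e b ^ edge_mult k I J e))"
    using D by (intro prod.mono_neutral_cong_right) auto
  finally show ?thesis .
qed

lemma no_simple_edge_iff: "no_simple_edge k I J \<longleftrightarrow> (\<forall>e\<in>walk_edges k I J. 2 \<le> edge_mult k I J e)"
  by (simp add: no_simple_edge_def walk_edges_def)

lemma edge_mult_pos: "e \<in> walk_edges k I J \<Longrightarrow> 1 \<le> edge_mult k I J e"
  unfolding walk_edges_def edge_mult_def by (auto simp: Suc_le_eq card_gt_0_iff)

lemma simple_edgeE:
  assumes "\<not> no_simple_edge k I J"
  obtains e where "e \<in> walk_edges k I J" "edge_mult k I J e = 1"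
proof -
  from assms obtain e where e: "e \<in> walk_edges k I J" "\<not> 2 \<le> edge_mult k I J e"
    unfolding no_simple_edge_iff by blast
  with edge_mult_pos[OF e(1)] have "edge_mult k I J e = 1" by linarith
  with e(1) show ?thesis by (rule that)
qed

text \<open>By independence the expectation factors over distinct edges. A simple edge contributes
  its mean, 0; an edge used at least twice contributes at most its variance, since entries bounded
  by 1 satisfy |x|^m \<le> x^2.\<close>

lemma expectation_walk_prod_le:
  fixes x :: "nat \<times> nat \<Rightarrow> 'b \<Rightarrow> real"
  assumes D: "finite D" "walk_edges k I J \<subseteq> D" and p: "\<And>e. e \<in> D \<Longrightarrow> finite (set_pmf (p e))"
    and bound: "\<And>e b. e \<in> D \<Longrightarrow> b \<in> set_pmf (p e) \<Longrightarrow> \<bar>x e b\<bar> \<le> 1"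
    and mean: "\<And>e. e \<in> D \<Longrightarrow> measure_pmf.expectation (p e) (x e) = 0"
    and var: "\<And>e. e \<in> D \<Longrightarrow> measure_pmf.expectation (p e) (\<lambda>b. (x e b)\<^sup>2) \<le> v"
  shows "measure_pmf.expectation (Pi_pmf D dflt p) (\<lambda>\<omega>. walk_prod k (\<lambda>i j. x (i, j) (\<omega> (i, j))) I J)
    \<le> (if no_simple_edge k I J then v ^ card (walk_edges k I J) else 0)"
proof (cases "no_simple_edge k I J")
  case False
  then obtain e where "e \<in> walk_edges k I J" "edge_mult k I J e = 1" by (rule simple_edgeE)
  then have "\<exists>e\<in>walk_edges k I J. measure_pmf.expectation (p e) (\<lambda>b. x e b ^ edge_mult k I J e) = 0"
    using mean[of e] D(2) by (intro bexI[of _ e]) auto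
  then have z: "(\<Prod>e\<in>walk_edges k I J. measure_pmf.expectation (p e) (\<lambda>b. x e b ^ edge_mult k I J e)) = 0"
    by (intro prod_zero) auto
  show ?thesis using False
    by (simp only: expectation_walk_prod[where p = p, OF D p] z) simp
next
  case True
  have "\<bar>measure_pmf.expectation (p e) (\<lambda>b. x e b ^ edge_mult k I J e)\<bar> \<le> v" if e: "e \<in> walk_edges k I J" for e
  proof -
    have eD: "e \<in> D" and m: "2 \<le> edge_mult k I J e"
      using e D(2) True by (auto simp: no_simple_edge_iff)
    have "\<bar>measure_pmf.expectation (p e) (\<lambda>b. x e b ^ edge_mult k I J e)\<bar>
        \<le> measure_pmf.expectation (p e) (\<lambda>b. \<bar>x e b ^ edge_mult k I J e\<bar>)"
      by (rule integral_abs_bound)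
    also have "\<dots> \<le> measure_pmf.expectation (p e) (\<lambda>b. (x e b)\<^sup>2)"
    proof (rule integral_mono_AE)
      show "AE b in measure_pmf (p e). \<bar>x e b ^ edge_mult k I J e\<bar> \<le> (x e b)\<^sup>2"
        using power_decreasing[OF m, of "\<bar>x e _\<bar>"] bound[OF eD]
        by (auto simp: AE_measure_pmf_iff power_abs)
    qed (auto intro!: integrable_measure_pmf_finite p eD)
    finally show ?thesis using var[OF eD] by simp
  qed
  then have "\<bar>\<Prod>e\<in>walk_edges k I J. measure_pmf.expectation (p e) (\<lambda>b. x e b ^ edge_mult k I J e)\<bar>
      \<le> (\<Prod>e\<in>walk_edges k I J. v)"
    unfolding abs_prod by (intro prod_mono) auto
  then show ?thesis using True
    by (simp add: expectation_walk_prod[where p = p, OF D p])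
qed

text \<open>The reverse comparison, meant for the yardstick entries: each surviving walk counts for
  at least 1, so an expected trace bounds the number of these walks from above.\<close>

lemma expectation_walk_prod_ge:
  fixes x :: "nat \<times> nat \<Rightarrow> 'b \<Rightarrow> real"
  assumes D: "finite D" "walk_edges k I J \<subseteq> D" and p: "\<And>e. e \<in> D \<Longrightarrow> finite (set_pmf (p e))"
    and mean: "\<And>e. e \<in> D \<Longrightarrow> measure_pmf.expectation (p e) (x e) = 0"
    and mom: "\<And>e m. e \<in> D \<Longrightarrow> 2 \<le> m \<Longrightarrow> 1 \<le> measure_pmf.expectation (p e) (\<lambda>b. x e b ^ m)"
  shows "(if no_simple_edge k I J then 1 else 0)
    \<le> measure_pmf.expectation (Pi_pmf D dflt p) (\<lambda>\<omega>. walk_prod k (\<lambda>i j. x (i, j) (\<omega> (i, j))) I J)"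
proof (cases "no_simple_edge k I J")
  case False
  then obtain e where "e \<in> walk_edges k I J" "edge_mult k I J e = 1" by (rule simple_edgeE)
  then have "\<exists>e\<in>walk_edges k I J. measure_pmf.expectation (p e) (\<lambda>b. x e b ^ edge_mult k I J e) = 0"
    using mean[of e] D(2) by (intro bexI[of _ e]) auto
  then have z: "(\<Prod>e\<in>walk_edges k I J. measure_pmf.expectation (p e) (\<lambda>b. x e b ^ edge_mult k I J e)) = 0"
    by (intro prod_zero) auto
  show ?thesis using False
    by (simp only: expectation_walk_prod[where p = p, OF D p] z) simp
next
  case True
  then have "1 \<le> (\<Prod>e\<in>walk_edges k I J. measure_pmf.expectation (p e) (\<lambda>b. x e b ^ edge_mult k I J e))"
    using D(2) by (intro prod_ge_1 mom) (auto simp: no_simple_edge_iff)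
  then show ?thesis using True
    by (simp add: expectation_walk_prod[where p = p, OF D p])
qed

definition dense_walks :: "nat \<Rightarrow> nat \<Rightarrow> nat \<Rightarrow> ((nat \<Rightarrow> nat) \<times> (nat \<Rightarrow> nat)) set" where
  "dense_walks d1 d2 k = {(I, J)\<in>closed_walks d1 d2 k. no_simple_edge k I J}"

lemma walk_edges_subset:
  assumes "(I, J) \<in> closed_walks d1 d2 k"
  shows "walk_edges k I J \<subseteq> {..<d1} \<times> {..<d2}"
  using assms by (fastforce simp: walk_edges_def walk_steps_def walk_edge_def closed_walks_def PiE_iff)

lemma finite_dense_walks [simp]: "finite (dense_walks d1 d2 k)"
  unfolding dense_walks_def by (rule finite_subset[OF _ finite_closed_walks]) auto

lemma expectation_trace_pow:
  fixes x :: "nat \<times> nat \<Rightarrow> 'b \<Rightarrow> real"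
  assumes p: "\<And>e. e \<in> {..<d1} \<times> {..<d2} \<Longrightarrow> finite (set_pmf (p e))"
  shows "measure_pmf.expectation (Pi_pmf ({..<d1} \<times> {..<d2}) dflt p) (\<lambda>\<omega>. trace_pow d1 d2 k (\<lambda>i j. x (i, j) (\<omega> (i, j))))
    = (\<Sum>(I, J)\<in>closed_walks d1 d2 k. measure_pmf.expectation (Pi_pmf ({..<d1} \<times> {..<d2}) dflt p) 
        (\<lambda>\<omega>. walk_prod k (\<lambda>i j. x (i, j) (\<omega> (i, j))) I J))"
proof -
  have "finite (set_pmf (Pi_pmf ({..<d1} \<times> {..<d2}) dflt p))"
    using p by (subst set_Pi_pmf) (auto intro!: finite_PiE_dflt)
  then show ?thesis unfolding trace_pow_def case_prod_unfold
    by (intro Bochner_Integration.integral_sum integrable_measure_pmf_finite)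
qed

lemma sum_closed_walks_dense:
  "(\<Sum>(I, J)\<in>closed_walks d1 d2 k. if no_simple_edge k I J then f I J else 0)
    = (\<Sum>(I, J)\<in>dense_walks d1 d2 k. (f I J :: real))"
  unfolding dense_walks_def
  by (rule sum.mono_neutral_cong_right) (auto simp: finite_closed_walks split: if_splits)

lemma expectation_trace_pow_le:
  fixes x :: "nat \<times> nat \<Rightarrow> 'b \<Rightarrow> real"
  assumes p: "\<And>e. e \<in> {..<d1} \<times> {..<d2} \<Longrightarrow> finite (set_pmf (p e))"
    and bound: "\<And>e b. e \<in> {..<d1} \<times> {..<d2} \<Longrightarrow> b \<in> set_pmf (p e) \<Longrightarrow> \<bar>x e b\<bar> \<le> 1"
    and mean: "\<And>e. e \<in> {..<d1} \<times> {..<d2} \<Longrightarrow> measure_pmf.expectation (p e) (x e) = 0"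
    and var: "\<And>e. e \<in> {..<d1} \<times> {..<d2} \<Longrightarrow> measure_pmf.expectation (p e) (\<lambda>b. (x e b)\<^sup>2) \<le> v"
  shows "measure_pmf.expectation (Pi_pmf ({..<d1} \<times> {..<d2}) dflt p) (\<lambda>\<omega>. trace_pow d1 d2 k (\<lambda>i j. x (i, j) (\<omega> (i, j))))
    \<le> (\<Sum>(I, J)\<in>dense_walks d1 d2 k. v ^ card (walk_edges k I J))"
proof -
  have "measure_pmf.expectation (Pi_pmf ({..<d1} \<times> {..<d2}) dflt p) (\<lambda>\<omega>. trace_pow d1 d2 k (\<lambda>i j. x (i, j) (\<omega> (i, j))))
    = (\<Sum>(I, J)\<in>closed_walks d1 d2 k. measure_pmf.expectation (Pi_pmf ({..<d1} \<times> {..<d2}) dflt p) 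
        (\<lambda>\<omega>. walk_prod k (\<lambda>i j. x (i, j) (\<omega> (i, j))) I J))"
    by (rule expectation_trace_pow) (rule p)
  also have "\<dots> \<le> (\<Sum>(I, J)\<in>closed_walks d1 d2 k. if no_simple_edge k I J then v ^ card (walk_edges k I J) else 0)"
  proof (rule sum_mono, clarify)
    fix I J assume "(I, J) \<in> closed_walks d1 d2 k"
    then show "measure_pmf.expectation (Pi_pmf ({..<d1} \<times> {..<d2}) dflt p)
        (\<lambda>\<omega>. walk_prod k (\<lambda>i j. x (i, j) (\<omega> (i, j))) I J)
      \<le> (if no_simple_edge k I J then v ^ card (walk_edges k I J) else 0)"
      by (intro expectation_walk_prod_le walk_edges_subset p bound mean var) simp_all
  qed
  finally show ?thesis by (simp only: sum_closed_walks_dense)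
qed

lemma expectation_trace_pow_ge:
  fixes x :: "nat \<times> nat \<Rightarrow> 'b \<Rightarrow> real"
  assumes p: "\<And>e. e \<in> {..<d1} \<times> {..<d2} \<Longrightarrow> finite (set_pmf (p e))"
    and mean: "\<And>e. e \<in> {..<d1} \<times> {..<d2} \<Longrightarrow> measure_pmf.expectation (p e) (x e) = 0"
    and mom: "\<And>e m. e \<in> {..<d1} \<times> {..<d2} \<Longrightarrow> 2 \<le> m \<Longrightarrow> 1 \<le> measure_pmf.expectation (p e) (\<lambda>b. x e b ^ m)"
  shows "real (card (dense_walks d1 d2 k))
    \<le> measure_pmf.expectation (Pi_pmf ({..<d1} \<times> {..<d2}) dflt p) (\<lambda>\<omega>. trace_pow d1 d2 k (\<lambda>i j. x (i, j) (\<omega> (i, j))))"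
proof -
  have "real (card (dense_walks d1 d2 k)) = (\<Sum>(I, J)\<in>dense_walks d1 d2 k. 1)"
    by (simp add: case_prod_unfold)
  also have "\<dots> = (\<Sum>(I, J)\<in>closed_walks d1 d2 k. if no_simple_edge k I J then 1 else 0)"
    by (rule sum_closed_walks_dense[symmetric])
  also have "\<dots> \<le> (\<Sum>(I, J)\<in>closed_walks d1 d2 k. measure_pmf.expectation (Pi_pmf ({..<d1} \<times> {..<d2}) dflt p) 
        (\<lambda>\<omega>. walk_prod k (\<lambda>i j. x (i, j) (\<omega> (i, j))) I J))"
  proof (rule sum_mono, clarify)
    fix I J assume "(I, J) \<in> closed_walks d1 d2 k"
    then show "(if no_simple_edge k I J then 1 else 0)
      \<le> measure_pmf.expectation (Pi_pmf ({..<d1} \<times> {..<d2}) dflt p)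
        (\<lambda>\<omega>. walk_prod k (\<lambda>i j. x (i, j) (\<omega> (i, j))) I J)"
      by (intro expectation_walk_prod_ge walk_edges_subset p mean mom) simp_all
  qed
  also have "\<dots> = measure_pmf.expectation (Pi_pmf ({..<d1} \<times> {..<d2}) dflt p) (\<lambda>\<omega>. trace_pow d1 d2 k (\<lambda>i j. x (i, j) (\<omega> (i, j))))"
    by (rule expectation_trace_pow[symmetric]) (rule p)
  finally show ?thesis .
qed


section \<open>Shapes of walks and relabelling of vertices\<close>

lemma card_walk_vertices_le:
  "card (I ` {..k}) + card (J ` {..<k}) \<le> card (walk_edges k I J) + 1"
proof (induction k)
  case 0
  have "{..0::nat} = {0}" by auto
  then show ?case by simp
next
  case (Suc k)
  let ?E = "walk_edges k I J" and ?e = "(I k, J k)" and ?e' = "(I (Suc k), J k)"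
  have E: "walk_edges (Suc k) I J = insert ?e' (insert ?e ?E)"
    by (auto simp: walk_edges_def walk_steps_def walk_edge_def lessThan_Suc image_iff split: if_splits)
  have 1: "?e \<notin> ?E" if "J k \<notin> J ` {..<k}"
    using that by (auto simp: walk_edges_def walk_steps_def walk_edge_def)
  have 2: "?e' \<notin> insert ?e ?E" if "I (Suc k) \<notin> I ` {..k}"
    using that by (auto simp: walk_edges_def walk_steps_def walk_edge_def split: if_splits)
  have "card (I ` {..Suc k}) + card (J ` {..<Suc k}) \<le> card (walk_edges (Suc k) I J) + 1"
    unfolding E atMost_Suc lessThan_Suc image_insert
    using Suc 1 2 by (cases "J k \<in> J ` {..<k}"; cases "I (Suc k) \<in> I ` {..k}")
      (simp_all add: card_insert_if del: image_eqI insert_iff)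
  then show ?case .
qed

text \<open>Both maps induce the same partition of \<open>S\<close>. For the row and column labels
  of a walk this is its shape.\<close>

definition same_kernel :: "'a set \<Rightarrow> ('a \<Rightarrow> 'b) \<Rightarrow> ('a \<Rightarrow> 'c) \<Rightarrow> bool" where
  "same_kernel S f g \<longleftrightarrow> (\<forall>s\<in>S. \<forall>t\<in>S. f s = f t \<longleftrightarrow> g s = g t)"

lemma same_kernel_card:
  assumes "same_kernel S f g"
  shows "card (f ` S) = card (g ` S)"
proof -
  define h where "h y = g (SOME s. s \<in> S \<and> f s = y)" for y
  have h: "h (f s) = g s" if "s \<in> S" for s
  proof -
    have "(SOME s'. s' \<in> S \<and> f s' = f s) \<in> S \<and> f (SOME s'. s' \<in> S \<and> f s' = f s) = f s"
      using that by (intro someI[of "\<lambda>s'. s' \<in> S \<and> f s' = f s" s]) simp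
    then show ?thesis using assms that unfolding h_def same_kernel_def by metis
  qed
  have "bij_betw h (f ` S) (g ` S)"
  proof (rule bij_betw_imageI)
    show "inj_on h (f ` S)"
      using assms h by (auto simp: inj_on_def same_kernel_def)
    show "h ` f ` S = g ` S" using h by (auto simp: image_image)
  qed
  then show ?thesis by (rule bij_betw_same_card)
qed

lemma same_kernel_commute: "same_kernel S f g \<longleftrightarrow> same_kernel S g f"
  unfolding same_kernel_def by blast

text \<open>A labelling with the kernel of \<open>f\<close> factors uniquely through
  \<open>f\<close>, by an injective renaming of the values of \<open>f\<close>.\<close>

lemma card_same_kernel:
  assumes S: "finite S"
  shows "card {g \<in> S \<rightarrow>\<^sub>E {..<n}. same_kernel S f g} = card {h \<in> f ` S \<rightarrow>\<^sub>E {..<n::nat}. inj_on h (f ` S)}"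
proof (rule sym, rule bij_betw_same_card)
  let ?A = "{h \<in> f ` S \<rightarrow>\<^sub>E {..<n}. inj_on h (f ` S)}"
  let ?F = "\<lambda>h. restrict (\<lambda>s. h (f s)) S"
  show "bij_betw ?F ?A {g \<in> S \<rightarrow>\<^sub>E {..<n}. same_kernel S f g}"
  proof (rule bij_betw_imageI)
    show "inj_on ?F ?A"
    proof (rule inj_onI)
      fix h h' assume h: "h \<in> ?A" "h' \<in> ?A" and eq: "?F h = ?F h'"
      have "h (f s) = h' (f s)" if "s \<in> S" for s
        using fun_cong[OF eq, of s] that by simp
      then have "h y = h' y" if "y \<in> f ` S" for y using that by blast
      then show "h = h'" using h by (intro PiE_ext[of h "f ` S" "\<lambda>_. {..<n}" h']) blast+
    qed
    show "?F ` ?A = {g \<in> S \<rightarrow>\<^sub>E {..<n}. same_kernel S f g}"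
    proof (intro equalityI subsetI)
      fix g assume "g \<in> ?F ` ?A"
      then obtain h where "h \<in> ?A" "g = ?F h" by blast
      then show "g \<in> {g \<in> S \<rightarrow>\<^sub>E {..<n}. same_kernel S f g}"
        by (auto simp: same_kernel_def inj_on_def PiE_iff)
    next
      fix g assume g: "g \<in> {g \<in> S \<rightarrow>\<^sub>E {..<n}. same_kernel S f g}"
      define h where "h = restrict (\<lambda>y. g (SOME s. s \<in> S \<and> f s = y)) (f ` S)"
      have h: "h (f s) = g s" if "s \<in> S" for s
      proof -
        have "(SOME s'. s' \<in> S \<and> f s' = f s) \<in> S \<and> f (SOME s'. s' \<in> S \<and> f s' = f s) = f s"
          using that by (intro someI[of "\<lambda>s'. s' \<in> S \<and> f s' = f s" s]) simp
        then have "g (SOME s'. s' \<in> S \<and> f s' = f s) = g s"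
          using g that unfolding same_kernel_def by blast
        then show ?thesis using that by (simp add: h_def)
      qed
      have "h \<in> ?A"
        using g h by (auto simp: inj_on_def same_kernel_def h_def PiE_iff)
      moreover have "g = ?F h"
        using g h by (intro ext) (auto simp: PiE_iff extensional_def)
      ultimately show "g \<in> ?F ` ?A" by blast
    qed
  qed
qed

lemma card_same_kernel_le:
  assumes "finite S"
  shows "card {g \<in> S \<rightarrow>\<^sub>E {..<n::nat}. same_kernel S f g} \<le> n ^ card (f ` S)"
proof -
  have "card {h \<in> f ` S \<rightarrow>\<^sub>E {..<n}. inj_on h (f ` S)} \<le> card (f ` S \<rightarrow>\<^sub>E {..<n})"
    using assms by (intro card_mono finite_PiE) auto
  then show ?thesis using assms by (simp add: card_same_kernel card_PiE)
qed

text \<open>The number of injections is a falling factorial with at most \<open>k + 1\<close>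
  factors, each at least \<open>n - k\<close>. The bound \<open>k + 1\<close> covers the rows, which
  have one more position than the columns.\<close>

lemma card_same_kernel_ge:
  assumes "finite S" "card S \<le> k + 1" "q + k \<le> n"
  shows "q ^ card (f ` S) \<le> card {g \<in> S \<rightarrow>\<^sub>E {..<n::nat}. same_kernel S f g}"
proof -
  have c: "card (f ` S) \<le> k + 1" using card_image_le[OF assms(1), of f] assms(2) by linarith
  have "q ^ card (f ` S) = (\<Prod>i\<in>{0..<card (f ` S)}. q)" by simp
  also have "\<dots> \<le> (\<Prod>i\<in>{0..<card (f ` S)}. n - i)"
    using c assms(3) by (intro prod_mono) auto
  also have "\<dots> = card {h \<in> f ` S \<rightarrow>\<^sub>E {..<n}. inj_on h (f ` S)}"
    using assms(1) by (subst card_inj_on_subset_funcset) auto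
  finally show ?thesis using assms(1) by (simp add: card_same_kernel)
qed


text \<open>Vertex labels in \<open>{..<d1}\<close> and \<open>{..<d2}\<close> are traded for labels in a set of size \<open>q + k\<close> by double
  counting pairs of walks of the same shape. A shape with \<open>v\<close> vertices has at most \<open>d\<^sup>v\<close> labellings on
  one side and at least \<open>q\<^sup>v\<close> on the other, and connectedness gives at least \<open>v - 1\<close> edges.\<close>

lemma sum_dense_walks_le:
  assumes d: "d = max d1 d2" "1 \<le> d" and q: "1 \<le> q"
    and v: "0 \<le> v" "v \<le> 1" "v \<le> real q / real d"
  shows "(\<Sum>(I, J)\<in>dense_walks d1 d2 k. v ^ card (walk_edges k I J))
    \<le> real d * real (card (dense_walks (q + k) (q + k) k))"
proof -
  let ?A = "dense_walks d1 d2 k" and ?B = "dense_walks (q + k) (q + k) k"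
  define sim :: "(nat \<Rightarrow> nat) \<times> (nat \<Rightarrow> nat) \<Rightarrow> (nat \<Rightarrow> nat) \<times> (nat \<Rightarrow> nat) \<Rightarrow> bool" where
    "sim w w' \<longleftrightarrow> same_kernel {..k} (fst w) (fst w') \<and> same_kernel {..<k} (snd w) (snd w')" for w w'
  define nv where "nv w = card (fst w ` {..k}) + card (snd w ` {..<k})" for w :: "(nat \<Rightarrow> nat) \<times> (nat \<Rightarrow> nat)"
  define ne where "ne w = card (walk_edges k (fst w) (snd w))" for w
  have sim_comm: "sim w w' \<longleftrightarrow> sim w' w" for w w'
    unfolding sim_def by (metis same_kernel_commute)
  have sim_nv: "nv w = nv w'" if "sim w w'" for w w'
    using that unfolding sim_def nv_def by (metis same_kernel_card)
  have sim_edge: "same_kernel (walk_steps k) (walk_edge (fst w) (snd w)) (walk_edge (fst w') (snd w'))"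
    if "sim w w'" for w w'
    using that unfolding sim_def same_kernel_def walk_steps_def walk_edge_def by auto
  have sim_ne: "ne w = ne w'" if "sim w w'" for w w'
    unfolding ne_def walk_edges_def by (rule same_kernel_card[OF sim_edge[OF that]])
  have sim_mult: "edge_mult k (fst w) (snd w) (walk_edge (fst w) (snd w) s)
      = edge_mult k (fst w') (snd w') (walk_edge (fst w') (snd w') s)"
    if "sim w w'" "s \<in> walk_steps k" for w w' s
    unfolding edge_mult_def using sim_edge[OF that(1)] that(2) unfolding same_kernel_def
    by (intro arg_cong[of _ _ card]) blast
  have sim_simple: "no_simple_edge k (fst w) (snd w) \<longleftrightarrow> no_simple_edge k (fst w') (snd w')" if "sim w w'" for w w'
    unfolding no_simple_edge_def using sim_mult[OF that] by auto
  \<comment> \<open>Being closed and having no simple edge depend only on the shape, so within a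
    class row labels and column labels are chosen independently.\<close>
  have class_eq: "{w' \<in> dense_walks m1 m2 k. sim w w'}
      = {g \<in> {..k} \<rightarrow>\<^sub>E {..<m1}. same_kernel {..k} (fst w) g} \<times> {g \<in> {..<k} \<rightarrow>\<^sub>E {..<m2}. same_kernel {..<k} (snd w) g}"
    (is "?L = ?R") if w: "w \<in> dense_walks n1 n2 k" for w m1 m2 n1 n2
  proof -
    have w0: "fst w 0 = fst w k" "no_simple_edge k (fst w) (snd w)"
      using w by (auto simp: dense_walks_def closed_walks_def)
    have "w' \<in> ?L \<longleftrightarrow> w' \<in> ?R" for w'
    proof -
      have "fst w' 0 = fst w' k \<and> no_simple_edge k (fst w') (snd w')" if "sim w w'"
        using that w0 sim_simple[OF that] unfolding sim_def same_kernel_def by (metis atMost_iff le0 order_refl)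
      then show ?thesis
        by (cases w') (auto simp: dense_walks_def closed_walks_def sim_def)
    qed
    then show ?thesis by blast
  qed
  have class_A: "card {w \<in> ?A. sim w w'} \<le> d ^ nv w'" if w': "w' \<in> ?B" for w'
  proof -
    have "card {w \<in> ?A. sim w w'} = card {w \<in> ?A. sim w' w}" using sim_comm by metis
    also have "\<dots> \<le> d1 ^ card (fst w' ` {..k}) * d2 ^ card (snd w' ` {..<k})"
      unfolding class_eq[OF w'] card_cartesian_product by (intro mult_mono card_same_kernel_le) auto
    also have "\<dots> \<le> d ^ card (fst w' ` {..k}) * d ^ card (snd w' ` {..<k})"
      using d by (intro mult_mono power_mono) auto
    finally show ?thesis by (simp add: nv_def power_add)
  qed
  have class_B: "q ^ nv w \<le> card {w' \<in> ?B. sim w w'}" if w: "w \<in> ?A" for w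
    unfolding class_eq[OF w] card_cartesian_product nv_def power_add
    by (intro mult_mono card_same_kernel_ge[where k = k]) auto
  have qv: "real q ^ n > 0" for n using q by simp
  \<comment> \<open>A tree has one vertex more than edges. The one factor \<open>d / q\<close> that
    no edge compensates is the origin of the factor \<open>d\<close>.\<close>
  have weight: "v ^ ne w * (real d ^ nv w / real q ^ nv w) \<le> real d" for w
  proof -
    have nv_ne: "nv w \<le> ne w + 1" unfolding nv_def ne_def by (rule card_walk_vertices_le)
    have nv0: "1 \<le> nv w" unfolding nv_def
      by (simp add: Suc_le_eq card_gt_0_iff add_pos_nonneg)
    have "v ^ ne w \<le> v ^ (nv w - 1)" using nv_ne v by (intro power_decreasing) auto
    also have "\<dots> \<le> (real q / real d) ^ (nv w - 1)" using v by (intro power_mono) auto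
    finally have *: "v ^ ne w \<le> (real q / real d) ^ (nv w - 1)" .
    have dq: "real d ^ nv w / real q ^ nv w = (real d / real q) * (real d / real q) ^ (nv w - 1)"
      using nv0 by (cases "nv w") (simp_all add: power_divide)
    have "v ^ ne w * (real d ^ nv w / real q ^ nv w)
        \<le> (real q / real d) ^ (nv w - 1) * (real d ^ nv w / real q ^ nv w)"
      using * by (intro mult_right_mono) auto
    also have "\<dots> = real d / real q"
    proof -
      have "(real q / real d) ^ m * (real d / real q) ^ m = 1" for m
        using q d(2) by (simp flip: power_mult_distrib)
      then show ?thesis unfolding dq by (simp only: mult.left_commute mult_1_right)
    qed
    also have "\<dots> \<le> real d" using q by (simp add: field_simps mult_le_cancel_left1)
    finally show ?thesis .
  qed
  have "(\<Sum>(I, J)\<in>?A. v ^ card (walk_edges k I J)) = (\<Sum>w\<in>?A. v ^ ne w)"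
    by (simp add: ne_def case_prod_unfold)
  also have "\<dots> \<le> (\<Sum>w\<in>?A. \<Sum>w'\<in>{w' \<in> ?B. sim w w'}. v ^ ne w / real q ^ nv w)"
  proof (rule sum_mono)
    fix w assume w: "w \<in> ?A"
    have "v ^ ne w = real q ^ nv w * (v ^ ne w / real q ^ nv w)"
      using q by simp
    also have "\<dots> \<le> real (card {w' \<in> ?B. sim w w'}) * (v ^ ne w / real q ^ nv w)"
      using class_B[OF w] v by (intro mult_right_mono) (auto simp flip: of_nat_power)
    finally show "v ^ ne w \<le> (\<Sum>w'\<in>{w' \<in> ?B. sim w w'}. v ^ ne w / real q ^ nv w)" by simp
  qed
  also have "\<dots> = (\<Sum>w'\<in>?B. \<Sum>w\<in>{w \<in> ?A. sim w w'}. v ^ ne w / real q ^ nv w)"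
    by (rule sum.swap_restrict) auto
  also have "\<dots> = (\<Sum>w'\<in>?B. \<Sum>w\<in>{w \<in> ?A. sim w w'}. v ^ ne w' / real q ^ nv w')"
    by (intro sum.cong refl) (auto simp: sim_ne sim_nv)
  also have "\<dots> \<le> (\<Sum>w'\<in>?B. real d)"
  proof (rule sum_mono)
    fix w' assume w': "w' \<in> ?B"
    have "(\<Sum>w\<in>{w \<in> ?A. sim w w'}. v ^ ne w' / real q ^ nv w')
        = real (card {w \<in> ?A. sim w w'}) * (v ^ ne w' / real q ^ nv w')" by simp
    also have "\<dots> \<le> real d ^ nv w' * (v ^ ne w' / real q ^ nv w')"
      using class_A[OF w'] v by (intro mult_right_mono) (auto simp flip: of_nat_power)
    also have "\<dots> \<le> real d" using weight[of w'] by (simp add: mult_ac)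
    finally show "(\<Sum>w\<in>{w \<in> ?A. sim w w'}. v ^ ne w' / real q ^ nv w') \<le> real d" .
  qed
  finally show ?thesis by (simp add: mult.commute)
qed

section \<open>Counting walks without simple edges\<close>

lemma power_le_fact_exp:
  fixes a :: real
  assumes "0 \<le> a"
  shows "a ^ n \<le> fact n * exp a"
proof -
  have "(\<Sum>i\<in>{n}. a ^ i /\<^sub>R fact i) \<le> (\<Sum>i. a ^ i /\<^sub>R fact i)"
    using assms by (intro sum_le_suminf sums_summable[OF exp_converges]) auto
  also have "\<dots> = exp a" by (simp add: exp_def)
  finally show ?thesis by (simp add: field_simps)
qed

text \<open>Integer points of the ball of radius \<open>4 \<surd>n\<close>; after division by \<open>4 \<surd>n\<close> they form a net of
  the unit ball.\<close>

definition lattice_net :: "nat \<Rightarrow> (nat \<Rightarrow> int) set" where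
  "lattice_net n = {z \<in> {..<n} \<rightarrow>\<^sub>E {- 16 * int n..16 * int n}. (\<Sum>i<n. (z i)\<^sup>2) \<le> 16 * int n}"

definition net_vec :: "nat \<Rightarrow> (nat \<Rightarrow> int) \<Rightarrow> nat \<Rightarrow> real" where
  "net_vec n z = (\<lambda>i. real_of_int (z i) / (4 * sqrt (real n)))"

lemma finite_lattice_net [simp]: "finite (lattice_net n)"
  unfolding lattice_net_def by (rule finite_subset[of _ "{..<n} \<rightarrow>\<^sub>E {- 16 * int n..16 * int n}"]) 
    (auto intro: finite_PiE)

lemma sum_half_power_abs_le: "(\<Sum>z\<in>{- int N..int N}. (1 / 2 :: real) ^ nat \<bar>z\<bar>) \<le> 3"
proof -
  have "(\<Sum>z\<in>{- int N..int N}. (1 / 2 :: real) ^ nat \<bar>z\<bar>) = 3 - 2 * (1 / 2) ^ N"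
  proof (induction N)
    case (Suc N)
    have "{- int (Suc N)..int (Suc N)} = insert (- int (Suc N)) (insert (int (Suc N)) {- int N..int N})"
      by auto
    then show ?case using Suc by (simp add: nat_add_distrib)
  qed simp
  then show ?thesis by simp
qed

lemma abs_le_power2_int: "\<bar>y\<bar> \<le> (y :: int)\<^sup>2"
  using self_le_power[of "\<bar>y\<bar>" 2] by (cases "y = 0") simp_all

text \<open>For integers |z| \<le> z^2, so on the net the weight \<open>2 ^ (16 * n)\<close> times
  the product of the \<open>(1 / 2) ^ nat \<bar>z i\<bar>\<close> is at least 1. Summed over the
  whole box this weight factorises, with at most 3 per coordinate.\<close>

lemma card_lattice_net: "real (card (lattice_net n)) \<le> (3 * 2 ^ 16) ^ n"
proof -
  let ?P = "{..<n} \<rightarrow>\<^sub>E {- 16 * int n..16 * int n}"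
  have "1 \<le> 2 ^ (16 * n) * (\<Prod>i<n. (1 / 2 :: real) ^ nat \<bar>z i\<bar>)" if z: "z \<in> lattice_net n" for z
  proof -
    have "(\<Sum>i<n. \<bar>z i\<bar>) \<le> (\<Sum>i<n. (z i)\<^sup>2)" by (intro sum_mono abs_le_power2_int)
    also have "\<dots> \<le> 16 * int n" using z by (simp add: lattice_net_def)
    also have "(\<Sum>i<n. \<bar>z i\<bar>) = int (\<Sum>i<n. nat \<bar>z i\<bar>)" by simp
    finally have le: "(\<Sum>i<n. nat \<bar>z i\<bar>) \<le> 16 * n" by linarith
    have "1 = (2 :: real) ^ (16 * n) * (1 / 2) ^ (16 * n)" by (simp flip: power_mult_distrib)
    also have "\<dots> \<le> 2 ^ (16 * n) * (1 / 2) ^ (\<Sum>i<n. nat \<bar>z i\<bar>)"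
      using le by (intro mult_left_mono power_decreasing) auto
    finally show ?thesis by (simp add: power_sum)
  qed
  then have "(\<Sum>z\<in>lattice_net n. 1) \<le> (\<Sum>z\<in>lattice_net n. 2 ^ (16 * n) * (\<Prod>i<n. (1 / 2 :: real) ^ nat \<bar>z i\<bar>))"
    by (intro sum_mono)
  also have "\<dots> \<le> (\<Sum>z\<in>?P. 2 ^ (16 * n) * (\<Prod>i<n. (1 / 2 :: real) ^ nat \<bar>z i\<bar>))"
  proof (rule sum_mono2)
    show "finite ?P" by (intro finite_PiE) simp_all
    show "lattice_net n \<subseteq> ?P" unfolding lattice_net_def by blast
  qed (intro mult_nonneg_nonneg prod_nonneg zero_le_power, simp_all)
  also have "\<dots> = 2 ^ (16 * n) * (\<Sum>z\<in>?P. \<Prod>i<n. (1 / 2 :: real) ^ nat \<bar>z i\<bar>)"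
    by (rule sum_distrib_left[symmetric])
  also have "\<dots> = 2 ^ (16 * n) * (\<Prod>i<n. \<Sum>y\<in>{- 16 * int n..16 * int n}. (1 / 2 :: real) ^ nat \<bar>y\<bar>)"
    by (subst prod_sum_PiE) simp_all
  also have "\<dots> \<le> 2 ^ (16 * n) * (\<Prod>i<n. 3)"
  proof (intro mult_left_mono prod_mono conjI)
    show "(\<Sum>y\<in>{- 16 * int n..16 * int n}. (1 / 2 :: real) ^ nat \<bar>y\<bar>) \<le> 3"
      using sum_half_power_abs_le[of "16 * n"] by simp
  qed (intro sum_nonneg zero_le_power, simp_all)
  also have "\<dots> = (3 * 2 ^ 16) ^ n"
    unfolding power_mult power_mult_distrib prod_constant card_lessThan by (rule mult.commute)
  finally show ?thesis by simp
qed

lemma vnorm_net_vec: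
  assumes "z \<in> lattice_net n" "1 \<le> n"
  shows "vnorm n (net_vec n z) \<le> 1"
proof (rule power2_le_imp_le)
  have "(vnorm n (net_vec n z))\<^sup>2 = real_of_int (\<Sum>i<n. (z i)\<^sup>2) / (16 * real n)"
    by (simp add: vnorm_power2 net_vec_def power_divide power_mult_distrib sum_divide_distrib)
  also have "\<dots> \<le> real_of_int (16 * int n) / (16 * real n)"
    using assms by (intro divide_right_mono) (auto simp: lattice_net_def simp del: of_int_sum)
  finally show "(vnorm n (net_vec n z))\<^sup>2 \<le> 1\<^sup>2" using assms(2) by simp
qed simp

text \<open>Scale by \<open>4 * sqrt n\<close> and round every coordinate towards zero. Absolute
  values do not grow, so the point stays in the ball; each coordinate moves by at most 1, in total
  by at most \<open>sqrt n\<close>, which is 1/4 after scaling back.\<close>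

lemma lattice_net_dense:
  assumes x: "vnorm n x \<le> 1" and n: "1 \<le> n"
  obtains z where "z \<in> lattice_net n" "vnorm n (\<lambda>i. x i - net_vec n z i) \<le> 1 / 4"
proof -
  let ?s = "4 * sqrt (real n)"
  have s: "?s > 0" using n by simp
  define tr where "tr y = (if 0 \<le> y then \<lfloor>y\<rfloor> else - \<lfloor>- y\<rfloor>)" for y :: real
  have tr: "\<bar>real_of_int (tr y)\<bar> \<le> \<bar>y\<bar>" "\<bar>y - real_of_int (tr y)\<bar> \<le> 1" for y
    unfolding tr_def by (auto; linarith)+
  define z where "z = restrict (\<lambda>i. tr (?s * x i)) {..<n}"
  have zi: "z i = tr (?s * x i)" if "i < n" for i using that by (simp add: z_def)
  have "(\<Sum>i<n. (real_of_int (z i))\<^sup>2) \<le> (\<Sum>i<n. (?s * x i)\<^sup>2)"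
    using tr(1) zi by (intro sum_mono) (simp add: abs_le_square_iff[symmetric])
  also have "\<dots> = 16 * real n * (vnorm n x)\<^sup>2"
    by (simp add: vnorm_power2 power_mult_distrib sum_distrib_left)
  also have "\<dots> \<le> 16 * real n * 1"
    using x by (intro mult_left_mono power_le_one) auto
  finally have "real_of_int (\<Sum>i<n. (z i)\<^sup>2) \<le> real_of_int (16 * int n)" by simp
  then have sum: "(\<Sum>i<n. (z i)\<^sup>2) \<le> 16 * int n" by (simp only: of_int_le_iff)
  have "\<bar>z i\<bar> \<le> 16 * int n" if "i < n" for i
  proof -
    have "\<bar>z i\<bar> \<le> (z i)\<^sup>2" by (rule abs_le_power2_int)
    also have "\<dots> \<le> (\<Sum>i<n. (z i)\<^sup>2)" using that by (intro member_le_sum) auto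
    finally show ?thesis using sum by linarith
  qed
  then have "z i \<in> {- 16 * int n..16 * int n}" if "i < n" for i
    using that by (force simp: abs_le_iff)
  then have "z \<in> lattice_net n"
    unfolding lattice_net_def using sum by (auto simp: PiE_iff z_def)
  moreover have "vnorm n (\<lambda>i. x i - net_vec n z i) \<le> 1 / 4"
  proof (rule power2_le_imp_le)
    have "(vnorm n (\<lambda>i. x i - net_vec n z i))\<^sup>2 \<le> (\<Sum>i<n. (1 / ?s)\<^sup>2)"
      unfolding vnorm_power2
    proof (rule sum_mono)
      fix i assume "i \<in> {..<n}"
      then have "x i - net_vec n z i = (?s * x i - real_of_int (tr (?s * x i))) / ?s"
        using s n by (simp add: net_vec_def zi field_simps)
      then have "\<bar>x i - net_vec n z i\<bar> = \<bar>?s * x i - real_of_int (tr (?s * x i))\<bar> / \<bar>?s\<bar>"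
        by (simp only: abs_divide)
      also have "\<dots> \<le> 1 / \<bar>?s\<bar>" by (rule divide_right_mono[OF tr(2)]) simp
      finally show "(x i - net_vec n z i)\<^sup>2 \<le> (1 / ?s)\<^sup>2"
        by (intro abs_le_square_iff[THEN iffD1]) (simp only: abs_divide abs_one)
    qed
    also have "\<dots> = (1 / 4)\<^sup>2" using n by (simp add: power_divide power_mult_distrib)
    finally show "(vnorm n (\<lambda>i. x i - net_vec n z i))\<^sup>2 \<le> (1 / 4)\<^sup>2" .
  qed simp
  ultimately show ?thesis by (rule that)
qed

section \<open>From a net to the operator norm\<close>

lemma mv_diff: "mv d M (\<lambda>j. x j - y j) i = mv d M x i - mv d M y i"
  by (simp add: mv_def algebra_simps sum_subtractf)

lemma op_bounded_form:
  assumes "op_bounded d1 d2 M c" "0 \<le> c"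
  shows "\<bar>ip d1 x (mv d2 M y)\<bar> \<le> c * vnorm d1 x * vnorm d2 y"
proof -
  have "\<bar>ip d1 x (mv d2 M y)\<bar> \<le> vnorm d1 x * vnorm d1 (mv d2 M y)" by (rule ip_Cauchy_Schwarz)
  also have "\<dots> \<le> vnorm d1 x * (c * vnorm d2 y)"
    using assms by (intro mult_left_mono) (auto simp: op_bounded_def)
  finally show ?thesis by (simp add: mult_ac)
qed

lemma op_bounded_of_form:
  assumes "\<And>x y. vnorm d1 x \<le> 1 \<Longrightarrow> vnorm d2 y \<le> 1 \<Longrightarrow> \<bar>ip d1 x (mv d2 M y)\<bar> \<le> c"
  shows "op_bounded d1 d2 M c"
proof (rule op_bounded_unit)
  fix y assume y: "vnorm d2 y \<le> 1"
  let ?w = "mv d2 M y"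
  show "vnorm d1 ?w \<le> c"
  proof (cases "vnorm d1 ?w = 0")
    case True
    have "\<bar>ip d1 (\<lambda>_. 0) ?w\<bar> \<le> c" by (rule assms) (use y in \<open>auto simp: vnorm_def L2_set_def\<close>)
    then show ?thesis using True by (simp add: ip_def)
  next
    case False
    then have p: "vnorm d1 ?w > 0" by (simp add: order_less_le)
    have "\<bar>ip d1 (\<lambda>i. inverse (vnorm d1 ?w) * ?w i) ?w\<bar> \<le> c"
      by (rule assms) (use y p in \<open>auto simp: vnorm_scale\<close>)
    moreover have "ip d1 (\<lambda>i. inverse (vnorm d1 ?w) * ?w i) ?w = vnorm d1 ?w"
      using p by (subst ip_commute)
        (simp add: ip_scale_right vnorm_power2_ip[symmetric] power2_eq_square)
    ultimately show ?thesis by simp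
  qed
qed

lemma op_bounded_exists: "\<exists>c\<ge>0. op_bounded d1 d2 M c"
proof -
  let ?S = "\<Sum>j<d2. (vnorm d1 (\<lambda>i. M i j))\<^sup>2"
  have "vnorm d1 (mv d2 M x) \<le> sqrt ?S * vnorm d2 x" for x
    by (rule power2_le_imp_le) (use vnorm_mv_le[of d1 d2 M x] in \<open>auto simp: power_mult_distrib sum_nonneg\<close>)
  then show ?thesis by (intro exI[of _ "sqrt ?S"]) (simp add: op_bounded_def sum_nonneg)
qed

text \<open>A bound \<open>c\<close> on the operator norm improves to \<open>m + c / 2\<close>; iterating gives \<open>2 m\<close>.\<close>

lemma op_bounded_of_net:
  assumes n: "1 \<le> n" and m: "0 \<le> m"
    and net: "\<And>y z. y \<in> lattice_net n \<Longrightarrow> z \<in> lattice_net n \<Longrightarrow> \<bar>ip n (net_vec n y) (mv n M (net_vec n z))\<bar> \<le> m"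
  shows "op_bounded n n M (2 * m)"
proof -
  have step: "op_bounded n n M (m + c / 2)" if c: "op_bounded n n M c" "0 \<le> c" for c
  proof (rule op_bounded_of_form)
    fix x y assume x: "vnorm n x \<le> 1" and y: "vnorm n y \<le> 1"
    obtain x' where x': "x' \<in> lattice_net n" "vnorm n (\<lambda>i. x i - net_vec n x' i) \<le> 1 / 4"
      using lattice_net_dense[OF x n] .
    obtain y' where y': "y' \<in> lattice_net n" "vnorm n (\<lambda>i. y i - net_vec n y' i) \<le> 1 / 4"
      using lattice_net_dense[OF y n] .
    let ?x = "net_vec n x'" and ?y = "net_vec n y'"
    \<comment> \<open>Both arguments are moved to net points. Each remainder has norm at most 1/4
      and costs \<open>c / 4\<close>.\<close>
    have "ip n x (mv n M y) = ip n ?x (mv n M ?y) + ip n (\<lambda>i. x i - ?x i) (mv n M y)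
        + ip n ?x (mv n M (\<lambda>i. y i - ?y i))"
      unfolding mv_diff ip_def left_diff_distrib right_diff_distrib sum_subtractf by simp
    moreover have "\<bar>ip n ?x (mv n M ?y)\<bar> \<le> m" by (rule net[OF x'(1) y'(1)])
    moreover have "\<bar>ip n (\<lambda>i. x i - ?x i) (mv n M y)\<bar> \<le> c * (1 / 4) * 1"
      by (rule order_trans[OF op_bounded_form[OF c]], intro mult_mono) (use x' y c in auto)
    moreover have "\<bar>ip n ?x (mv n M (\<lambda>i. y i - ?y i))\<bar> \<le> c * 1 * (1 / 4)"
      by (rule order_trans[OF op_bounded_form[OF c]], intro mult_mono)
        (use y' c vnorm_net_vec[OF x'(1) n] in auto)
    ultimately show "\<bar>ip n x (mv n M y)\<bar> \<le> m + c / 2" by linarith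
  qed
  \<comment> \<open>The iteration may start from any finite bound, as its influence is halved in
    every round.\<close>
  obtain c where c: "0 \<le> c" "op_bounded n n M c" using op_bounded_exists by blast
  have it: "op_bounded n n M (2 * m + c / 2 ^ N)" for N
  proof (induction N)
    case 0
    have "c * vnorm n x \<le> (2 * m + c) * vnorm n x" for x
      using m by (intro mult_right_mono) auto
    then show ?case using c unfolding op_bounded_def by (auto intro: order_trans)
  next
    case (Suc N)
    have "op_bounded n n M (m + (2 * m + c / 2 ^ N) / 2)"
      using m c by (intro step Suc) auto
    then show ?case by (simp add: field_simps)
  qed
  show ?thesis unfolding op_bounded_def
  proof
    fix x
    have "(\<lambda>N. (2 * m + c * (1 / 2) ^ N) * vnorm n x) \<longlonglongrightarrow> (2 * m + c * 0) * vnorm n x"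
      by (intro tendsto_intros LIMSEQ_realpow_zero) auto
    moreover have "vnorm n (mv n M x) \<le> (2 * m + c * (1 / 2) ^ N) * vnorm n x" for N
      using it[of N] by (simp add: op_bounded_def power_divide)
    ultimately show "vnorm n (mv n M x) \<le> 2 * m * vnorm n x"
      by (intro LIMSEQ_le_const[of _ "2 * m * vnorm n x"]) auto
  qed
qed

text \<open>A centred two-point variable with all higher moments at least 1, used as a yardstick.\<close>

definition skew :: "bool \<Rightarrow> real" where "skew b = (if b then 2 else -1)"

lemma skew_mean: "measure_pmf.expectation (bernoulli_pmf (1 / 3)) skew = 0"
  by (simp add: skew_def)

text \<open>A symmetric sign has vanishing odd moments and would miss walks that use an edge three
  times. With the values 2 and -1 the odd moments from the third on are positive too.\<close>

lemma skew_moment: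
  assumes "2 \<le> m"
  shows "1 \<le> measure_pmf.expectation (bernoulli_pmf (1 / 3)) (\<lambda>b. skew b ^ m)"
proof -
  have E: "measure_pmf.expectation (bernoulli_pmf (1 / 3)) (\<lambda>b. skew b ^ m) = (2 ^ m + 2 * (-1) ^ m) / 3"
    by (simp add: skew_def)
  show ?thesis
  proof (cases "even m")
    case True
    have "(2 :: real) ^ 2 \<le> 2 ^ m" using assms by (intro power_increasing) auto
    then show ?thesis unfolding E using True by simp
  next
    case False
    then have "3 \<le> m" using assms by (cases "m = 2") auto
    then have "(2 :: real) ^ 3 \<le> 2 ^ m" by (intro power_increasing) auto
    then show ?thesis unfolding E using False by simp
  qed
qed

text \<open>Hoeffding's lemma for a variable of range 3, whence \<open>3\<^sup>2 / 8\<close>.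
  Negative \<open>s\<close> is handled by reflecting the variable, which exchanges the weights 1/3
  and 2/3.\<close>

lemma skew_mgf: "measure_pmf.expectation (bernoulli_pmf (1 / 3)) (\<lambda>b. exp (s * skew b)) \<le> exp (9 / 8 * s\<^sup>2)"
proof -
  have aux: "exp (- h * p) * (1 + p * (exp h - 1)) \<le> exp (h\<^sup>2 / 8)" if "0 \<le> h" "0 \<le> p" for h p :: real
  proof -
    have pos: "1 + p * (exp h - 1) > 0" using that by (simp add: add_pos_nonneg)
    have "exp (- h * p + ln (1 + p * (exp h - 1))) \<le> exp (h\<^sup>2 / 8)"
      using Hoeffdings_lemma_aux[OF that] by simp
    then show ?thesis using pos by (simp only: exp_add exp_ln)
  qed
  have E: "measure_pmf.expectation (bernoulli_pmf (1 / 3)) (\<lambda>b. exp (s * skew b)) = exp (2 * s) / 3 + 2 * exp (- s) / 3"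
    by (simp add: skew_def mult.commute)
  show ?thesis
  proof (cases "0 \<le> s")
    case True
    have "exp (2 * s) / 3 + 2 * exp (- s) / 3 = exp (- (3 * s) * (1 / 3)) * (1 + 1 / 3 * (exp (3 * s) - 1))"
      by (simp add: algebra_simps flip: exp_add)
    also have "\<dots> \<le> exp ((3 * s)\<^sup>2 / 8)" using True by (intro aux) auto
    finally show ?thesis unfolding E by (simp add: power_mult_distrib)
  next
    case False
    have "exp (2 * s) / 3 + 2 * exp (- s) / 3 = exp (- (- 3 * s) * (2 / 3)) * (1 + 2 / 3 * (exp (- 3 * s) - 1))"
      by (simp add: algebra_simps flip: exp_add)
    also have "\<dots> \<le> exp ((- 3 * s)\<^sup>2 / 8)" using False by (intro aux) auto
    finally show ?thesis unfolding E by (simp add: power_mult_distrib)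
  qed
qed

definition skew_pmf :: "nat \<Rightarrow> (nat \<times> nat \<Rightarrow> bool) pmf" where
  "skew_pmf n = Pi_pmf ({..<n} \<times> {..<n}) False (\<lambda>_. bernoulli_pmf (1 / 3))"

lemma finite_set_skew_pmf [simp]: "finite (set_pmf (skew_pmf n))"
  unfolding skew_pmf_def by (subst set_Pi_pmf) (auto intro!: finite_PiE_dflt)

lemma integrable_skew_pmf [simp]: "integrable (measure_pmf (skew_pmf n)) (f :: _ \<Rightarrow> real)"
  by (rule integrable_measure_pmf_finite) simp

text \<open>By independence the exponential moments multiply, and the squares of the coefficients
  \<open>s * (x i * y j)\<close> sum to at most \<open>s\<^sup>2\<close>, whatever the
  dimension.\<close>

lemma skew_form_mgf:
  assumes "vnorm n x \<le> 1" "vnorm n y \<le> 1"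
  shows "measure_pmf.expectation (skew_pmf n) (\<lambda>\<omega>. exp (s * ip n x (mv n (\<lambda>i j. skew (\<omega> (i, j))) y)))
    \<le> exp (9 / 8 * s\<^sup>2)"
proof -
  let ?D = "{..<n} \<times> {..<n}"
  define c where "c = (\<lambda>(i, j). s * (x i * y j))"
  have form: "s * ip n x (mv n (\<lambda>i j. skew (\<omega> (i, j))) y) = (\<Sum>e\<in>?D. c e * skew (\<omega> e))" for \<omega>
    unfolding ip_def mv_def c_def sum_distrib_left
    by (simp add: sum.cartesian_product case_prod_unfold mult_ac)
  have "measure_pmf.expectation (skew_pmf n) (\<lambda>\<omega>. exp (s * ip n x (mv n (\<lambda>i j. skew (\<omega> (i, j))) y)))
      = measure_pmf.expectation (skew_pmf n) (\<lambda>\<omega>. \<Prod>e\<in>?D. exp (c e * skew (\<omega> e)))"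
    unfolding form by (simp add: exp_sum)
  also have "\<dots> = (\<Prod>e\<in>?D. measure_pmf.expectation (bernoulli_pmf (1 / 3)) (\<lambda>b. exp (c e * skew b)))"
    unfolding skew_pmf_def by (rule expectation_prod_Pi_pmf_finite) auto
  also have "\<dots> \<le> (\<Prod>e\<in>?D. exp (9 / 8 * (c e)\<^sup>2))"
    by (intro prod_mono conjI skew_mgf Bochner_Integration.integral_nonneg) auto
  also have "\<dots> = exp (9 / 8 * (\<Sum>e\<in>?D. (c e)\<^sup>2))"
    by (simp add: exp_sum sum_distrib_left)
  also have "(\<Sum>e\<in>?D. (c e)\<^sup>2) = s\<^sup>2 * ((vnorm n x)\<^sup>2 * (vnorm n y)\<^sup>2)"
    unfolding vnorm_power2 sum_product
    by (simp add: c_def sum_distrib_left sum.cartesian_product case_prod_unfold power_mult_distrib)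
  also have "exp (9 / 8 * (s\<^sup>2 * ((vnorm n x)\<^sup>2 * (vnorm n y)\<^sup>2))) \<le> exp (9 / 8 * s\<^sup>2)"
    using assms by (simp add: mult_left_le mult_le_one power_le_one)
  finally show ?thesis .
qed

text \<open>One term of the exponential series at the tilt \<open>s = sqrt k\<close> bounds the
  moment. This tilt makes both costs exponential in \<open>k\<close> up to the power of
  \<open>k\<close>: \<open>fact (2 * k) / k ^ k\<close> is at most \<open>(4 * k) ^ k\<close>, and
  the exponential moment is at most \<open>exp (9 / 8 * k)\<close>.\<close>

lemma skew_form_moment:
  assumes xy: "vnorm n x \<le> 1" "vnorm n y \<le> 1" and k: "1 \<le> k"
  shows "measure_pmf.expectation (skew_pmf n) (\<lambda>\<omega>. (ip n x (mv n (\<lambda>i j. skew (\<omega> (i, j))) y)) ^ (2 * k))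
    \<le> 2 * (4 * exp 2 * real k) ^ k"
proof -
  let ?f = "\<lambda>\<omega>. ip n x (mv n (\<lambda>i j. skew (\<omega> (i, j))) y)" and ?s = "sqrt (real k)"
  let ?c = "fact (2 * k) / real k ^ k :: real"
  have sk: "?s ^ (2 * k) = real k ^ k" using k by (simp add: power_mult)
  have pt: "?f \<omega> ^ (2 * k) \<le> ?c * (exp (?s * ?f \<omega>) + exp (- ?s * ?f \<omega>))" for \<omega>
  proof -
    have "real k ^ k * ?f \<omega> ^ (2 * k) = (?s * \<bar>?f \<omega>\<bar>) ^ (2 * k)"
      by (simp add: power_mult_distrib sk power_even_abs)
    also have "\<dots> \<le> fact (2 * k) * exp (?s * \<bar>?f \<omega>\<bar>)"
      by (rule power_le_fact_exp) simp
    also have "exp (?s * \<bar>?f \<omega>\<bar>) \<le> exp (?s * ?f \<omega>) + exp (- ?s * ?f \<omega>)"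
      by (cases "0 \<le> ?f \<omega>") (auto simp: abs_if)
    finally show ?thesis using k by (simp add: field_simps)
  qed
  have "measure_pmf.expectation (skew_pmf n) (\<lambda>\<omega>. ?f \<omega> ^ (2 * k))
      \<le> measure_pmf.expectation (skew_pmf n) (\<lambda>\<omega>. ?c * (exp (?s * ?f \<omega>) + exp (- ?s * ?f \<omega>)))"
    by (intro integral_mono pt) auto
  also have "\<dots> = ?c * (measure_pmf.expectation (skew_pmf n) (\<lambda>\<omega>. exp (?s * ?f \<omega>))
      + measure_pmf.expectation (skew_pmf n) (\<lambda>\<omega>. exp (- ?s * ?f \<omega>)))"
    by (subst Bochner_Integration.integral_add[symmetric]) simp_all
  also have "\<dots> \<le> ?c * (exp (9 / 8 * ?s\<^sup>2) + exp (9 / 8 * (- ?s)\<^sup>2))"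
    by (intro mult_left_mono add_mono skew_form_mgf xy) auto
  also have "\<dots> = 2 * (?c * exp (9 / 8 * real k))" by simp
  also have "\<dots> \<le> 2 * ((4 * real k) ^ k * exp 2 ^ k)"
  proof -
    have "fact (2 * k) \<le> real ((2 * k) ^ (2 * k))" by (rule fact_le_power)
    also have "\<dots> = (4 * real k) ^ k * real k ^ k"
      by (simp add: power_mult power_mult_distrib power2_eq_square)
    finally have "?c \<le> (4 * real k) ^ k" using k by (simp add: field_simps)
    moreover have "exp (9 / 8 * real k) \<le> exp 2 ^ k" by (simp flip: exp_of_nat_mult)
    ultimately show ?thesis by (intro mult_left_mono mult_mono) auto
  qed
  finally show ?thesis by (simp add: power_mult_distrib mult_ac)
qed

text \<open>Factor by factor: 12 absorbs the prefactor \<open>6 * k\<close>, 4 is the squared loss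
  of 2 in passing from the net to the norm, the sixth power counts pairs of net points in dimension
  \<open>3 * k\<close>, and \<open>4 * exp 2\<close> comes from the moments.\<close>

definition walk_const :: real where
  "walk_const = 12 * 4 * (3 * 2 ^ 16) ^ 6 * (4 * exp 2)"

lemma walk_const_pos: "0 < walk_const"
  by (simp add: walk_const_def)

text \<open>The maximum over pairs of net points is replaced by the \<open>2 * k\<close>-th root of
  the sum of \<open>2 * k\<close>-th powers. Inside the trace bound the root disappears, leaving a
  sum to which linearity of expectation applies.\<close>

lemma skew_trace_pow:
  assumes k: "1 \<le> k"
  shows "measure_pmf.expectation (skew_pmf (3 * k)) (\<lambda>\<omega>. trace_pow (3 * k) (3 * k) k (\<lambda>i j. skew (\<omega> (i, j))))
    \<le> (walk_const * real k) ^ k"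
proof -
  define n where "n = 3 * k"
  have n: "1 \<le> n" using k by (simp add: n_def)
  let ?N = "lattice_net n"
  let ?W = "\<lambda>\<omega> i j. skew (\<omega> (i, j :: nat))" 
  let ?f = "\<lambda>\<omega> y z. ip n (net_vec n y) (mv n (?W \<omega>) (net_vec n z))"
  have pt: "trace_pow n n k (?W \<omega>) \<le> real n * 4 ^ k * (\<Sum>y\<in>?N. \<Sum>z\<in>?N. ?f \<omega> y z ^ (2 * k))" for \<omega>
  proof -
    define S where "S = (\<Sum>y\<in>?N. \<Sum>z\<in>?N. ?f \<omega> y z ^ (2 * k))"
    have S0: "0 \<le> S" unfolding S_def by (intro sum_nonneg) simp
    define m where "m = root (2 * k) S"
    have m: "0 \<le> m" "m ^ (2 * k) = S" using S0 k by (simp_all add: m_def)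
    have "\<bar>?f \<omega> y z\<bar> \<le> m" if "y \<in> ?N" "z \<in> ?N" for y z
    proof -
      have "\<bar>?f \<omega> y z\<bar> ^ (2 * k) = ?f \<omega> y z ^ (2 * k)" by (simp add: power_even_abs)
      also have "\<dots> \<le> (\<Sum>z\<in>?N. ?f \<omega> y z ^ (2 * k))"
        using that by (intro member_le_sum[of z ?N "\<lambda>z. ?f \<omega> y z ^ (2 * k)"]) auto
      also have "\<dots> \<le> S" unfolding S_def
        using that by (intro member_le_sum[of y ?N "\<lambda>y. \<Sum>z\<in>?N. ?f \<omega> y z ^ (2 * k)"]) (auto intro!: sum_nonneg)
      finally have "\<bar>?f \<omega> y z\<bar> ^ (2 * k) \<le> m ^ (2 * k)" unfolding m(2) .
      then show ?thesis by (subst (asm) power_mono_iff) (use m(1) k in auto)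
    qed
    then have "op_bounded n n (?W \<omega>) (2 * m)" by (intro op_bounded_of_net n m) auto
    then have "trace_pow n n k (?W \<omega>) \<le> real n * (2 * m) ^ (2 * k)"
      using m by (intro trace_pow_le_op_bounded) auto
    also have "\<dots> = real n * 4 ^ k * S"
      by (simp add: power_mult_distrib m) (simp add: power_mult)
    finally show ?thesis by (simp add: S_def)
  qed
  have "measure_pmf.expectation (skew_pmf n) (\<lambda>\<omega>. trace_pow n n k (?W \<omega>))
      \<le> measure_pmf.expectation (skew_pmf n) (\<lambda>\<omega>. real n * 4 ^ k * (\<Sum>y\<in>?N. \<Sum>z\<in>?N. ?f \<omega> y z ^ (2 * k)))"
    by (intro integral_mono pt) auto
  also have "\<dots> = real n * 4 ^ k * (\<Sum>y\<in>?N. \<Sum>z\<in>?N. measure_pmf.expectation (skew_pmf n) (\<lambda>\<omega>. ?f \<omega> y z ^ (2 * k)))"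
    by (simp add: Bochner_Integration.integral_sum)
  also have "\<dots> \<le> real n * 4 ^ k * (\<Sum>y\<in>?N. \<Sum>z\<in>?N. 2 * (4 * exp 2 * real k) ^ k)"
    by (intro mult_left_mono sum_mono skew_form_moment vnorm_net_vec n k) auto
  also have "\<dots> = 6 * real k * 4 ^ k * (4 * exp 2 * real k) ^ k * (real (card ?N) * real (card ?N))"
    by (simp add: n_def)
  also have "\<dots> \<le> 6 * real k * 4 ^ k * (4 * exp 2 * real k) ^ k * ((3 * 2 ^ 16) ^ n * (3 * 2 ^ 16) ^ n)"
    by (intro mult_left_mono mult_mono card_lattice_net) auto
  also have "(3 * 2 ^ 16) ^ n * (3 * 2 ^ 16) ^ n = ((3 * 2 ^ 16) ^ 6 :: real) ^ k"
    unfolding n_def power_mult[symmetric] power_add[symmetric] by simp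
  also have "6 * real k * 4 ^ k * (4 * exp 2 * real k) ^ k * ((3 * 2 ^ 16) ^ 6) ^ k
      \<le> 12 ^ k * 4 ^ k * (4 * exp 2 * real k) ^ k * ((3 * 2 ^ 16) ^ 6) ^ k"
  proof -
    have "real k \<le> 2 ^ k" by (simp add: of_nat_less_two_power less_imp_le)
    moreover have "(6::real) ^ 1 \<le> 6 ^ k" using k by (intro power_increasing) auto
    ultimately have "6 * real k \<le> 6 ^ k * 2 ^ k" by (intro mult_mono) auto
    then have "6 * real k \<le> 12 ^ k" by (simp flip: power_mult_distrib)
    then show ?thesis by (intro mult_right_mono) auto
  qed
  also have "\<dots> = (walk_const * real k) ^ k"
    unfolding walk_const_def power_mult_distrib by (simp only: mult_ac)
  finally show ?thesis unfolding n_def .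
qed

lemma card_dense_walks_le:
  assumes "1 \<le> k"
  shows "real (card (dense_walks (3 * k) (3 * k) k)) \<le> (walk_const * real k) ^ k"
proof -
  have "real (card (dense_walks (3 * k) (3 * k) k))
      \<le> measure_pmf.expectation (skew_pmf (3 * k)) (\<lambda>\<omega>. trace_pow (3 * k) (3 * k) k (\<lambda>i j. skew (\<omega> (i, j))))"
    unfolding skew_pmf_def
    by (rule expectation_trace_pow_ge[where x = "\<lambda>_. skew", OF _ skew_mean skew_moment]) simp_all
  then show ?thesis using skew_trace_pow[OF assms] by linarith
qed

section \<open>The sampling error\<close>

text \<open>Markov's inequality for the trace power at level \<open>(K * k) ^ k\<close>. Relabelling
  is used with \<open>q = 2 * k\<close>, which matches the variance hypothesis and makes the
  alphabet size \<open>q + k\<close> equal to \<open>3 * k\<close>.\<close>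

lemma random_matrix_op_bounded:
  fixes x :: "nat \<times> nat \<Rightarrow> 'b \<Rightarrow> real"
  assumes d: "d = max d1 d2" "1 \<le> d" and k: "k = 2 ^ Suc m" and K: "0 < K"
    and p: "\<And>e. e \<in> {..<d1} \<times> {..<d2} \<Longrightarrow> finite (set_pmf (p e))"
    and bound: "\<And>e b. e \<in> {..<d1} \<times> {..<d2} \<Longrightarrow> b \<in> set_pmf (p e) \<Longrightarrow> \<bar>x e b\<bar> \<le> 1"
    and mean: "\<And>e. e \<in> {..<d1} \<times> {..<d2} \<Longrightarrow> measure_pmf.expectation (p e) (x e) = 0"
    and var: "\<And>e. e \<in> {..<d1} \<times> {..<d2} \<Longrightarrow> measure_pmf.expectation (p e) (\<lambda>b. (x e b)\<^sup>2) \<le> 2 * real k / real d"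
  shows "measure_pmf.prob (Pi_pmf ({..<d1} \<times> {..<d2}) dflt p)
      {\<omega>. \<not> op_bounded d1 d2 (\<lambda>i j. x (i, j) (\<omega> (i, j))) (sqrt (K * real k))}
    \<le> real d * (walk_const / K) ^ k"
proof -
  let ?P = "Pi_pmf ({..<d1} \<times> {..<d2}) dflt p" and ?X = "\<lambda>\<omega> i j. x (i, j) (\<omega> (i, j))"
  let ?T = "\<lambda>\<omega>. trace_pow d1 d2 k (?X \<omega>)"
  \<comment> \<open>Capping at 1 makes \<open>v ^ m\<close> decrease in the number \<open>m\<close>
    of edges; entries bounded by 1 have variance at most 1.\<close>
  define v where "v = min 1 (2 * real k / real d)"
  have k1: "1 \<le> k" by (simp add: k)
  have fin: "finite (set_pmf ?P)"
    using p by (subst set_Pi_pmf) (auto intro!: finite_PiE_dflt)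
  have var': "measure_pmf.expectation (p e) (\<lambda>b. (x e b)\<^sup>2) \<le> v" if e: "e \<in> {..<d1} \<times> {..<d2}" for e
  proof -
    have "measure_pmf.expectation (p e) (\<lambda>b. (x e b)\<^sup>2) \<le> measure_pmf.expectation (p e) (\<lambda>b. 1)"
    proof (rule integral_mono_AE)
      show "AE b in measure_pmf (p e). (x e b)\<^sup>2 \<le> 1"
        using bound[OF e] by (auto simp: AE_measure_pmf_iff abs_square_le_1)
    qed (auto intro!: integrable_measure_pmf_finite p e)
    then show ?thesis using var[OF e] by (simp add: v_def)
  qed
  have ET: "measure_pmf.expectation ?P ?T \<le> real d * (walk_const * real k) ^ k"
  proof -
    have "measure_pmf.expectation ?P ?T \<le> (\<Sum>(I, J)\<in>dense_walks d1 d2 k. v ^ card (walk_edges k I J))"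
      by (intro expectation_trace_pow_le p bound mean var')
    also have "\<dots> \<le> real d * real (card (dense_walks (2 * k + k) (2 * k + k) k))"
      using k1 by (intro sum_dense_walks_le d) (auto simp: v_def)
    also have "\<dots> \<le> real d * (walk_const * real k) ^ k"
      using card_dense_walks_le[OF k1] by (intro mult_left_mono) (simp_all add: mult.commute)
    finally show ?thesis .
  qed
  have T0: "0 \<le> ?T \<omega>" for \<omega>
    unfolding k power_Suc trace_pow_double by (intro sum_nonneg) simp
  have pos: "0 < (K * real k) ^ k" using K k1 by simp
  have "{\<omega>. \<not> op_bounded d1 d2 (?X \<omega>) (sqrt (K * real k))} \<subseteq> {\<omega>\<in>space (measure_pmf ?P). (K * real k) ^ k \<le> ?T \<omega>}"
  proof
    fix \<omega> assume "\<omega> \<in> {\<omega>. \<not> op_bounded d1 d2 (?X \<omega>) (sqrt (K * real k))}"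
    then have "\<not> ?T \<omega> \<le> sqrt (K * real k) ^ (2 * 2 ^ Suc m)"
      using op_bounded_of_trace_pow[of d1 d2 m "?X \<omega>" "sqrt (K * real k)"] K by (auto simp: k)
    moreover have "sqrt (K * real k) ^ (2 * 2 ^ Suc m) = (K * real k) ^ k"
      using K unfolding power_mult k[symmetric] by simp
    ultimately show "\<omega> \<in> {\<omega>\<in>space (measure_pmf ?P). (K * real k) ^ k \<le> ?T \<omega>}" by simp
  qed
  then have "measure_pmf.prob ?P {\<omega>. \<not> op_bounded d1 d2 (?X \<omega>) (sqrt (K * real k))}
      \<le> measure_pmf.prob ?P {\<omega>\<in>space (measure_pmf ?P). (K * real k) ^ k \<le> ?T \<omega>}"
    by (intro measure_pmf.finite_measure_mono) auto
  also have "\<dots> \<le> measure_pmf.expectation ?P ?T / (K * real k) ^ k"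
    using pos T0 fin
    by (intro integral_Markov_inequality_measure[where A = UNIV]) (auto intro: integrable_measure_pmf_finite)
  also have "\<dots> \<le> real d * (walk_const * real k) ^ k / (K * real k) ^ k"
    using ET pos by (intro divide_right_mono) auto
  also have "\<dots> = real d * (walk_const / K) ^ k"
    using k1 by (simp add: power_mult_distrib power_divide)
  finally show ?thesis .
qed

section \<open>Moments and size of the sampled entries\<close>

lemma fro_norm_power2: "(fro_norm d1 d2 A)\<^sup>2 = (\<Sum>i<d1. \<Sum>j<d2. (A i j)\<^sup>2)"
  by (simp add: fro_norm_def sum_nonneg)

text \<open>Cauchy-Schwarz over at most \<open>d\<^sup>2\<close> entries. It expresses the entrywise
  bound, which involves the l1 norm, on the Frobenius scale of the variance.\<close>

lemma l1_norm_le_fro_norm: "l1_norm d1 d2 A \<le> real (max d1 d2) * fro_norm d1 d2 A"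
proof -
  let ?S = "{..<d1} \<times> {..<d2}"
  have "l1_norm d1 d2 A = (\<Sum>e\<in>?S. \<bar>1\<bar> * \<bar>case e of (i, j) \<Rightarrow> A i j\<bar>)"
    by (simp add: l1_norm_def sum.cartesian_product case_prod_unfold)
  also have "\<dots> \<le> L2_set (\<lambda>_. 1) ?S * L2_set (\<lambda>(i, j). A i j) ?S"
    by (rule L2_set_mult_ineq)
  also have "L2_set (\<lambda>_. 1 :: real) ?S = sqrt (real d1 * real d2)"
    by (simp add: L2_set_constant)
  also have "sqrt (real d1 * real d2) \<le> sqrt (real (max d1 d2) * real (max d1 d2))"
    by (intro real_sqrt_le_mono mult_mono) auto
  also have "\<dots> = real (max d1 d2)" by simp
  finally show ?thesis by (simp add: fro_norm_L2_set mult_right_mono)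
qed

lemma abs_entry_le_l1_norm:
  assumes "i < d1" "j < d2"
  shows "\<bar>A i j\<bar> \<le> l1_norm d1 d2 A"
proof -
  have "\<bar>A i j\<bar> \<le> (\<Sum>j<d2. \<bar>A i j\<bar>)" using assms by (intro member_le_sum[of j "{..<d2}" "\<lambda>j. \<bar>A i j\<bar>"]) auto
  also have "\<dots> \<le> l1_norm d1 d2 A" unfolding l1_norm_def
    using assms by (intro member_le_sum[of i "{..<d1}" "\<lambda>i. \<Sum>j<d2. \<bar>A i j\<bar>"]) (auto intro: sum_nonneg)
  finally show ?thesis .
qed

text \<open>The two summands of the sampling probability control, respectively, the variance and the size of
  an entry of \<open>P\<^sub>\<Omega>(A) - A\<close>.\<close>

lemma samp_entry:
  fixes A :: "nat \<Rightarrow> nat \<Rightarrow> real" and n :: real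
  assumes ij: "i < d1" "j < d2" and n: "0 < n" and F: "0 < fro_norm d1 d2 A"
  defines "p \<equiv> samp_prob d1 d2 n A i j"
  defines "y \<equiv> \<lambda>b. A i j * (if b then 1 else 0) / p - A i j"
  shows "measure_pmf.expectation (bernoulli_pmf p) y = 0"
    and "measure_pmf.expectation (bernoulli_pmf p) (\<lambda>b. (y b)\<^sup>2) \<le> 2 * (fro_norm d1 d2 A)\<^sup>2 / n"
    and "b \<in> set_pmf (bernoulli_pmf p) \<Longrightarrow> \<bar>y b\<bar> \<le> 2 * l1_norm d1 d2 A / n"
proof -
  let ?a = "A i j" and ?F = "fro_norm d1 d2 A" and ?L = "l1_norm d1 d2 A"
  have L0: "0 \<le> ?L" by (simp add: l1_norm_def sum_nonneg)
  have aL: "\<bar>?a\<bar> \<le> ?L" by (rule abs_entry_le_l1_norm[where A = A, OF ij])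
  have p01: "0 \<le> p" "p \<le> 1" using n L0 by (auto simp: p_def samp_prob_def)
  show "measure_pmf.expectation (bernoulli_pmf p) y = 0" 
    and "measure_pmf.expectation (bernoulli_pmf p) (\<lambda>b. (y b)\<^sup>2) \<le> 2 * ?F\<^sup>2 / n"
    and "b \<in> set_pmf (bernoulli_pmf p) \<Longrightarrow> \<bar>y b\<bar> \<le> 2 * ?L / n"
  \<comment> \<open>A zero entry is sampled with probability 0 and its error vanishes identically.
    For all other entries \<open>p\<close> is positive and may be divided by.\<close>
  proof (atomize (full), cases "?a = 0")
    case True
    then have "y = (\<lambda>b. 0)" by (simp add: y_def fun_eq_iff)
    then show "measure_pmf.expectation (bernoulli_pmf p) y = 0 \<and>
        measure_pmf.expectation (bernoulli_pmf p) (\<lambda>b. (y b)\<^sup>2) \<le> 2 * ?F\<^sup>2 / n \<and>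
        (b \<in> set_pmf (bernoulli_pmf p) \<longrightarrow> \<bar>y b\<bar> \<le> 2 * ?L / n)"
      using n L0 by simp
  next
    case False
    then have Lp: "?L > 0" using aL by linarith
    define u where "u = n / 2 * (?a\<^sup>2 / ?F\<^sup>2)"
    define w where "w = n / 2 * (\<bar>?a\<bar> / ?L)"
    have uw: "0 < u" "0 < w" using n F Lp False by (simp_all add: u_def w_def)
    have p: "p = min (u + w) 1" by (simp add: p_def samp_prob_def u_def w_def distrib_left)
    have p0: "0 < p" using uw by (simp add: p)
    have mean: "measure_pmf.expectation (bernoulli_pmf p) y = 0"
      using p0 p01 by (simp add: y_def field_simps)
    have "measure_pmf.expectation (bernoulli_pmf p) (\<lambda>b. (y b)\<^sup>2) = ?a\<^sup>2 * (1 - p) / p"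
      using p0 p01 by (simp add: y_def field_simps power2_eq_square)
    also have "\<dots> \<le> 2 * ?F\<^sup>2 / n"
    \<comment> \<open>At the cap the entry is observed almost surely and the variance is 0; below it
      \<open>p\<close> is the sum \<open>u + w\<close> and dominates each summand.\<close>
    proof (cases "p = 1")
      case True
      then show ?thesis using n by simp
    next
      case False
      then have "u \<le> p" using uw by (simp add: p)
      have "?a\<^sup>2 * (1 - p) / p \<le> ?a\<^sup>2 / p"
        using p0 by (intro divide_right_mono) (auto simp: mult_left_le)
      also have "\<dots> \<le> ?a\<^sup>2 / u" using \<open>u \<le> p\<close> uw by (intro divide_left_mono) auto
      also have "\<dots> = 2 * ?F\<^sup>2 / n" using n F \<open>?a \<noteq> 0\<close> by (simp add: u_def)
      finally show ?thesis .
    qed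
    finally have var: "measure_pmf.expectation (bernoulli_pmf p) (\<lambda>b. (y b)\<^sup>2) \<le> 2 * ?F\<^sup>2 / n" .
    have "\<bar>y b\<bar> \<le> 2 * ?L / n" if b: "b \<in> set_pmf (bernoulli_pmf p)" for b
    proof (cases "p = 1")
      case True
      then have "b" using b by (cases b) (auto simp: set_pmf_iff)
      then have "y b = 0" using True by (simp add: y_def)
      then show ?thesis using n L0 by simp
    next
      case False
      then have wp: "w \<le> p" using uw by (simp add: p)
      have "\<bar>y b\<bar> \<le> \<bar>?a\<bar> / p"
      proof (cases b)
        case True
        have "y b = ?a / p * (1 - p)" using True p0 by (simp add: y_def field_simps)
        then have "\<bar>y b\<bar> = \<bar>?a\<bar> / p * (1 - p)" using p0 p01 by (simp add: abs_mult)
        also have "\<dots> \<le> \<bar>?a\<bar> / p" using p0 by (intro mult_left_le) auto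
        finally show ?thesis .
      next
        case False
        then have "\<bar>y b\<bar> = \<bar>?a\<bar>" by (simp add: y_def)
        also have "\<dots> \<le> \<bar>?a\<bar> / p" using p0 p01 by (simp add: pos_le_divide_eq mult_left_le)
        finally show ?thesis .
      qed
      also have "\<dots> \<le> \<bar>?a\<bar> / w" using wp uw by (intro divide_left_mono) auto
      also have "\<dots> = 2 * ?L / n" using n Lp \<open>?a \<noteq> 0\<close> by (simp add: w_def)
      finally show ?thesis .
    qed
    with mean var show "measure_pmf.expectation (bernoulli_pmf p) y = 0 \<and>
        measure_pmf.expectation (bernoulli_pmf p) (\<lambda>b. (y b)\<^sup>2) \<le> 2 * ?F\<^sup>2 / n \<and>
        (b \<in> set_pmf (bernoulli_pmf p) \<longrightarrow> \<bar>y b\<bar> \<le> 2 * ?L / n)" by blast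
  qed
qed

lemma op_bounded_scale:
  assumes "op_bounded d1 d2 M c" "0 \<le> t"
  shows "op_bounded d1 d2 (\<lambda>i j. t * M i j) (t * c)"
proof -
  have "mv d2 (\<lambda>i j. t * M i j) x = (\<lambda>i. t * mv d2 M x i)" for x
    by (simp add: mv_def sum_distrib_left mult_ac)
  then show ?thesis using assms
    by (simp add: op_bounded_def vnorm_scale mult_left_mono mult.assoc)
qed

lemma op_bounded_mono: "op_bounded d1 d2 M c \<Longrightarrow> c \<le> c' \<Longrightarrow> op_bounded d1 d2 M c'"
  unfolding op_bounded_def by (meson mult_right_mono order_trans vnorm_nonneg)

text \<open>The extra \<open>exp 2\<close> makes Markov's bound decay like
  \<open>exp (- 2 * k)\<close>, which is at most \<open>exp (- q)\<close> because
  \<open>q \<le> 2 * k\<close>.\<close>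

definition sampling_const :: real where
  "sampling_const = walk_const * exp 2"

lemma sampling_const_pos: "0 < sampling_const"
  using walk_const_pos by (simp add: sampling_const_def)

lemma sampling_error_op_bounded:
  fixes A :: "nat \<Rightarrow> nat \<Rightarrow> real" and n :: real
  assumes d: "d = max d1 d2" "2 \<le> d" and F: "0 < fro_norm d1 d2 A" and \<alpha>: "0 < \<alpha>"
    and n: "8 * real d * ((1 + \<alpha>) * ln (real d)) \<le> n"
  defines "p \<equiv> samp_prob d1 d2 n A"
  shows "measure_pmf.prob (Omega_pmf d1 d2 p)
      {\<omega>. \<not> op_bounded d1 d2 (\<lambda>i j. P_Omega \<omega> p A i j - A i j)
        (fro_norm d1 d2 A * sqrt (2 * sampling_const * real d / n))}
    \<le> real d powr (- \<alpha>)"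
proof -
  let ?F = "fro_norm d1 d2 A"
  define q where "q = n / (2 * real d)"
  have d0: "0 < real d" using d(2) by simp
  \<comment> \<open>Together with the constant 8 in the assumption on \<open>n\<close> this forces
    \<open>2 \<le> q\<close>, so that a power of two with positive exponent fits below
    \<open>q\<close>.\<close>
  have ln_d: "1 / 2 \<le> ln (real d)"
  proof -
    have "1 / 2 \<le> ln (2 :: real)" using ln2_ge_two_thirds by simp
    also have "\<dots> \<le> ln (real d)" using d(2) by (intro ln_mono) auto
    finally show ?thesis .
  qed
  have q_ge: "4 * ((1 + \<alpha>) * ln (real d)) \<le> q"
    using n d0 by (simp add: q_def field_simps)
  have "1 / 2 \<le> (1 + \<alpha>) * ln (real d)"
    using \<alpha> ln_d mult_mono[of 1 "1 + \<alpha>" "1 / 2" "ln (real d)"] by simp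
  then have q2: "2 \<le> q" using q_ge by linarith
  have n0: "0 < n" using q2 d0 by (simp add: q_def field_simps)
  \<comment> \<open>The largest power of two not exceeding \<open>q\<close> becomes
    \<open>k\<close>. Hence \<open>k \<le> q\<close>, which controls the norm bound, and
    \<open>q \<le> 2 * k\<close>, which controls variance and probability.\<close>
  obtain N where N: "2 ^ N \<le> nat \<lfloor>q\<rfloor>" "nat \<lfloor>q\<rfloor> < 2 ^ (N + 1)"
    using ex_power_ivl1[of 2 "nat \<lfloor>q\<rfloor>"] q2 by (auto simp: le_nat_floor)
  have "N \<noteq> 0" using N(2) q2 by (intro notI) (simp add: nat_less_iff floor_less_iff)
  then obtain m where m: "N = Suc m" by (cases N) auto
  define k :: nat where "k = 2 ^ Suc m"
  have kq: "real k \<le> q" "q \<le> 2 * real k"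
  proof -
    have "k \<le> nat \<lfloor>q\<rfloor>" using N(1) by (simp add: k_def m)
    then show "real k \<le> q" using q2 by linarith
    have "nat \<lfloor>q\<rfloor> < 2 * k" using N(2) by (simp add: k_def m)
    then show "q \<le> 2 * real k" using q2 by linarith
  qed
  \<comment> \<open>\<open>L\<close> bounds the entries of the error. Division by it brings the
    variance bound \<open>2 * ?F\<^sup>2 / n\<close> to exactly \<open>q / d\<close>.\<close>
  define L where "L = 2 * real d * ?F / n"
  have L0: "0 < L" using d0 F n0 by (simp add: L_def)
  define x where "x = (\<lambda>(i, j) b. (A i j * (if b then 1 else 0) / p i j - A i j) / L)"
  let ?D = "{..<d1} \<times> {..<d2}" and ?pe = "\<lambda>(i, j). bernoulli_pmf (p i j)"
  note entry = samp_entry[OF _ _ n0 F, folded p_def]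
  have mean: "measure_pmf.expectation (?pe e) (x e) = 0" if "e \<in> ?D" for e
    using that entry(1) by (auto simp: x_def simp del: integral_bernoulli_pmf)
  have var: "measure_pmf.expectation (?pe e) (\<lambda>b. (x e b)\<^sup>2) \<le> 2 * real k / real d" if e: "e \<in> ?D" for e
  proof -
    obtain i j where ij: "e = (i, j)" "i < d1" "j < d2" using e by auto
    have "measure_pmf.expectation (?pe e) (\<lambda>b. (x e b)\<^sup>2)
        = measure_pmf.expectation (bernoulli_pmf (p i j)) (\<lambda>b. (A i j * (if b then 1 else 0) / p i j - A i j)\<^sup>2) / L\<^sup>2"
      by (simp add: x_def ij power_divide del: integral_bernoulli_pmf)
    also have "\<dots> \<le> (2 * ?F\<^sup>2 / n) / L\<^sup>2"
      using ij by (intro divide_right_mono entry(2)) auto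
    also have "\<dots> = q / real d"
      using F n0 d0 by (simp add: L_def q_def field_simps power2_eq_square)
    also have "\<dots> \<le> 2 * real k / real d" using kq d0 by (intro divide_right_mono) auto
    finally show ?thesis .
  qed
  have bound: "\<bar>x e b\<bar> \<le> 1" if e: "e \<in> ?D" "b \<in> set_pmf (?pe e)" for e b
  proof -
    obtain i j where ij: "e = (i, j)" "i < d1" "j < d2" using e by auto
    have "\<bar>A i j * (if b then 1 else 0) / p i j - A i j\<bar> \<le> 2 * l1_norm d1 d2 A / n"
      using e ij by (intro entry(3)) auto
    also have "\<dots> \<le> L" unfolding L_def d(1)
      using l1_norm_le_fro_norm[of d1 d2 A] n0 by (intro divide_right_mono) auto
    finally show ?thesis using L0 by (simp add: x_def ij)
  qed
  have "measure_pmf.prob (Omega_pmf d1 d2 p)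
      {\<omega>. \<not> op_bounded d1 d2 (\<lambda>i j. x (i, j) (\<omega> (i, j))) (sqrt (sampling_const * real k))}
    \<le> real d * (walk_const / sampling_const) ^ k"
    unfolding Omega_pmf_def
    by (rule random_matrix_op_bounded[OF d(1) _ k_def sampling_const_pos _ bound mean var])
      (use d(2) in auto)
  also have "\<dots> = real d * exp (- 2 * real k)"
  proof -
    have "walk_const / sampling_const = exp (- 2)"
      using walk_const_pos by (simp add: sampling_const_def exp_minus field_simps)
    then show ?thesis by (simp only: exp_of_nat_mult[symmetric] mult.commute)
  qed
  also have "\<dots> \<le> real d * exp (- ((1 + \<alpha>) * ln (real d)))"
  proof -
    have "0 \<le> (1 + \<alpha>) * ln (real d)" using \<alpha> ln_d by (intro mult_nonneg_nonneg) linarith+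
    then have "(1 + \<alpha>) * ln (real d) \<le> 2 * real k" using q_ge kq(2) by linarith
    then show ?thesis using d0 by simp
  qed
  also have "\<dots> = real d powr (- \<alpha>)"
  proof -
    have "exp (- ((1 + \<alpha>) * ln (real d))) = exp (- ln (real d)) * exp (- \<alpha> * ln (real d))"
      by (simp add: algebra_simps flip: exp_add)
    then show ?thesis using d0 by (simp add: powr_def exp_minus)
  qed
  finally have main: "measure_pmf.prob (Omega_pmf d1 d2 p)
      {\<omega>. \<not> op_bounded d1 d2 (\<lambda>i j. x (i, j) (\<omega> (i, j))) (sqrt (sampling_const * real k))} \<le> real d powr (- \<alpha>)" .
  have "op_bounded d1 d2 (\<lambda>i j. P_Omega \<omega> p A i j - A i j) (?F * sqrt (2 * sampling_const * real d / n))"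
    if "op_bounded d1 d2 (\<lambda>i j. x (i, j) (\<omega> (i, j))) (sqrt (sampling_const * real k))" for \<omega>
  proof -
    have "op_bounded d1 d2 (\<lambda>i j. L * x (i, j) (\<omega> (i, j))) (L * sqrt (sampling_const * real k))"
      using that L0 by (intro op_bounded_scale) auto
    moreover have "L * x (i, j) (\<omega> (i, j)) = P_Omega \<omega> p A i j - A i j" for i j
      using L0 by (simp add: x_def P_Omega_def)
    moreover have "L * sqrt (sampling_const * real k) \<le> ?F * sqrt (2 * sampling_const * real d / n)"
    proof (rule power2_le_imp_le)
      have "(L * sqrt (sampling_const * real k))\<^sup>2 = L\<^sup>2 * (sampling_const * real k)"
        using sampling_const_pos by (simp add: power_mult_distrib)
      also have "\<dots> \<le> L\<^sup>2 * (sampling_const * q)"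
        using kq sampling_const_pos by (intro mult_left_mono) auto
      also have "\<dots> = (?F * sqrt (2 * sampling_const * real d / n))\<^sup>2"
        using sampling_const_pos n0 d0 by (simp add: power_mult_distrib L_def q_def field_simps power2_eq_square)
      finally show "(L * sqrt (sampling_const * real k))\<^sup>2 \<le> (?F * sqrt (2 * sampling_const * real d / n))\<^sup>2" .
    qed (use F n0 d0 sampling_const_pos in simp)
    ultimately show ?thesis by (auto intro: op_bounded_mono)
  qed
  then have "measure_pmf.prob (Omega_pmf d1 d2 p)
      {\<omega>. \<not> op_bounded d1 d2 (\<lambda>i j. P_Omega \<omega> p A i j - A i j) (?F * sqrt (2 * sampling_const * real d / n))}
    \<le> measure_pmf.prob (Omega_pmf d1 d2 p)
      {\<omega>. \<not> op_bounded d1 d2 (\<lambda>i j. x (i, j) (\<omega> (i, j))) (sqrt (sampling_const * real k))}"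
    by (intro measure_pmf.finite_measure_mono) auto
  then show ?thesis using main by linarith
qed


section \<open>Assembling the probabilistic and the deterministic bound\<close>

lemma singular_value_zero_of_zero_matrix:
  assumes svd: "is_svd d1 d2 A U V s" and F: "fro_norm d1 d2 A = 0" and l: "l < min d1 d2"
  shows "s l = 0"
proof -
  have "(\<Sum>i<d1. \<Sum>j<d2. (A i j)\<^sup>2) = 0" using F fro_norm_power2[of d1 d2 A] by simp
  then have A0: "A i j = 0" if "i < d1" "j < d2" for i j
    using that by (simp add: sum_nonneg_eq_0_iff sum_nonneg)
  have "vnorm d1 (\<lambda>i. s l * U i l) = vnorm d1 (\<lambda>i. 0)"
  proof (rule vnorm_cong)
    fix i assume i: "i < d1"
    then have "mv d2 A (\<lambda>j. V j l) i = 0" using A0 by (simp add: mv_def)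
    then show "s l * U i l = 0" using svd_mv_right_vector[OF svd i l] by simp
  qed
  then show ?thesis
    using vnorm_orthonormal[OF is_svd_orthonormal(1)[OF svd], of l] l
    by (simp add: vnorm_scale) (simp add: vnorm_def L2_set_def)
qed

text \<open>The perturbation bound contains the ratio of the value after the cut to the gap. That
  value is at most its geometric mean with the largest singular value, which yields the square
  root.\<close>

lemma trunc_svd_error:
  assumes B: "is_trunc_svd d1 d2 M r B" and Ar: "is_trunc_svd d1 d2 A r Ar"
    and r: "1 \<le> r" "r \<le> min d1 d2"
    and E: "op_bounded d1 d2 (\<lambda>i j. M i j - A i j) e" "0 \<le> e"
    and gap: "sing_val d1 d2 A (r + 1) < sing_val d1 d2 A r"
      "e \<le> (sing_val d1 d2 A r - sing_val d1 d2 A (r + 1)) / 2"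
  shows "fro_norm d1 d2 (\<lambda>i j. B i j - Ar i j) \<le> sqrt (real r) * e *
    (4 * (1 + sqrt (sing_val d1 d2 A (r + 1) * sing_val d1 d2 A 1) / (sing_val d1 d2 A r - sing_val d1 d2 A (r + 1))))"
proof -
  obtain U' V' s' where svdM: "is_svd d1 d2 M U' V' s'"
    and B': "\<And>i j. i < d1 \<Longrightarrow> j < d2 \<Longrightarrow> B i j = (\<Sum>l<r. s' l * U' i l * V' j l)"
    using B r(2) unfolding is_trunc_svd_def by (auto simp: min_absorb1)
  obtain U V s where svdA: "is_svd d1 d2 A U V s"
    and Ar': "\<And>i j. i < d1 \<Longrightarrow> j < d2 \<Longrightarrow> Ar i j = (\<Sum>l<r. s l * U i l * V j l)"
    using Ar r(2) unfolding is_trunc_svd_def by (auto simp: min_absorb1)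
  define t where "t = sing_val d1 d2 A (r + 1)"
  define g where "g = sing_val d1 d2 A r - t"
  define a where "a = sing_val d1 d2 A 1"
  \<comment> \<open>For \<open>r = min d1 d2\<close> the tail is empty and the next singular value
    is 0 by convention.\<close>
  have t_eq: "t = (if r < min d1 d2 then s r else 0)"
    using sing_val_eq[OF svdA, of "r + 1"] by (auto simp: t_def sing_val_def)
  have sr: "sing_val d1 d2 A r = s (r - 1)" using sing_val_eq[OF svdA] r by simp
  have a: "a = s 0" using sing_val_eq[OF svdA, of 1] r by (simp add: a_def)
  have t0: "0 \<le> t" using is_svd_nonneg[OF svdA] by (simp add: t_eq)
  have ta: "t \<le> a"
    using is_svd_decreasing[OF svdA, of 0 r] is_svd_nonneg[OF svdA, of 0] r by (auto simp: t_eq a)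
  have g0: "0 < g" using gap by (simp add: g_def t_def)
  have "fro_norm d1 d2 (\<lambda>i j. B i j - Ar i j)
      = fro_norm d1 d2 (\<lambda>i j. (\<Sum>l<r. s' l * U' i l * V' j l) - (\<Sum>l<r. s l * U i l * V j l))"
    by (rule fro_norm_cong) (simp add: B' Ar')
  also have "\<dots> \<le> sqrt (real r) * e * (3 + 4 * t / g)"
  proof (rule svd_truncation_perturbation[OF svdA svdM E r _ t0 g0])
    show "s k \<le> t" if "r \<le> k" "k < min d1 d2" for k
      using is_svd_decreasing[OF svdA that] that by (simp add: t_eq)
    show "t + g \<le> s (r - 1)" by (simp add: g_def sr)
    show "e \<le> g / 2" using gap by (simp add: g_def t_def)
  qed
  also have "\<dots> \<le> sqrt (real r) * e * (4 * (1 + sqrt (t * a) / g))"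
  proof -
    have "t = sqrt (t * t)" using t0 by simp
    also have "\<dots> \<le> sqrt (t * a)" using t0 ta by (intro real_sqrt_le_mono mult_left_mono)
    finally have "t / g \<le> sqrt (t * a) / g" using g0 by (intro divide_right_mono) auto
    then show ?thesis using E(2) by (intro mult_left_mono) auto
  qed
  finally show ?thesis by (simp add: t_def g_def a_def)
qed

theorem theorem1:
  shows "\<exists>C1 C2 :: real. C1 > 0 \<and> C2 > 0 \<and>
    (\<forall>(\<alpha>::real) (d1::nat) (d2::nat) (A::nat \<Rightarrow> nat \<Rightarrow> real) (n::real) (r::nat).
      let d = max d1 d2; p = samp_prob d1 d2 n A;
          \<sigma> = sing_val d1 d2 A;
          gap = \<sigma> r - \<sigma> (r + 1) in
      \<alpha> > 0 \<and> n > 0 \<and> 1 \<le> r \<and> r < d \<and> \<sigma> r > \<sigma> (r + 1) \<and>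
      n \<ge> C2 * real d * max ((1 + \<alpha>) * ln (real d)) ((fro_norm d1 d2 A)\<^sup>2 / gap\<^sup>2)
      \<longrightarrow>
      measure_pmf.prob (Omega_pmf d1 d2 p)
        {\<omega>. \<forall>B Ar. is_trunc_svd d1 d2 (P_Omega \<omega> p A) r B \<longrightarrow> is_trunc_svd d1 d2 A r Ar \<longrightarrow>
              fro_norm d1 d2 (\<lambda>i j. B i j - Ar i j)
                \<le> C1 * fro_norm d1 d2 A * sqrt (real r * real d / n) *
                   (1 + sqrt (\<sigma> (r + 1) * \<sigma> 1) / gap)}
      \<ge> 1 - real d powr (- \<alpha>))"
proof -
  \<comment> \<open>In \<open>C1\<close>, 4 comes from the truncation estimate and the root from the
    norm bound \<open>e\<close>. In \<open>C2\<close>, 8 serves the logarithmic condition, and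
    \<open>8 * sampling_const\<close> is what squaring \<open>e \<le> gap / 2\<close>
    requires.\<close>
  define C1 where "C1 = 4 * sqrt (2 * sampling_const)"
  define C2 where "C2 = 8 + 8 * sampling_const"
  have C: "0 < C1" "0 < C2" using sampling_const_pos by (simp_all add: C1_def C2_def)
  have main: "1 - real d powr (- \<alpha>) \<le> measure_pmf.prob (Omega_pmf d1 d2 p)
        {\<omega>. \<forall>B Ar. is_trunc_svd d1 d2 (P_Omega \<omega> p A) r B \<longrightarrow> is_trunc_svd d1 d2 A r Ar \<longrightarrow>
              fro_norm d1 d2 (\<lambda>i j. B i j - Ar i j)
                \<le> C1 * fro_norm d1 d2 A * sqrt (real r * real d / n) *
                   (1 + sqrt (\<sigma> (r + 1) * \<sigma> 1) / gap)}"
      (is "_ \<le> measure_pmf.prob ?P ?good")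
    if d: "d = max d1 d2" and p: "p = samp_prob d1 d2 n A" and \<sigma>: "\<sigma> = sing_val d1 d2 A"
      and gap: "gap = \<sigma> r - \<sigma> (r + 1)" and \<alpha>: "\<alpha> > 0" and n0: "n > 0" and r: "1 \<le> r" "r < d"
      and gt: "\<sigma> r > \<sigma> (r + 1)"
      and n: "n \<ge> C2 * real d * max ((1 + \<alpha>) * ln (real d)) ((fro_norm d1 d2 A)\<^sup>2 / gap\<^sup>2)"
    for \<alpha> n gap :: real and d d1 d2 r :: nat and A p :: "nat \<Rightarrow> nat \<Rightarrow> real" and \<sigma> :: "nat \<Rightarrow> real"
  \<comment> \<open>If \<open>A\<close> had no decomposition, the event would hold vacuously for
    every outcome.\<close>
  proof (cases "\<exists>U V s. is_svd d1 d2 A U V s")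
    case False
    then have "?good = UNIV" by (auto simp: is_trunc_svd_def)
    then show ?thesis using measure_pmf.prob_space[of ?P] by simp
  next
    case True
    then obtain U V s where svd: "is_svd d1 d2 A U V s" by blast
    \<comment> \<open>Beyond \<open>min d1 d2\<close> all singular values are 0 by convention, so a
      strict gap confines \<open>r\<close>. The gap likewise forces \<open>A\<close> to be nonzero,
      as the scaling of the error requires.\<close>
    have rm: "r \<le> min d1 d2" using gt by (auto simp: \<sigma> sing_val_def split: if_splits)
    have g0: "0 < gap" using gt by (simp add: gap)
    have \<sigma>r: "\<sigma> r = s (r - 1)" using sing_val_eq[OF svd] r rm by (simp add: \<sigma>)
    have "0 \<le> \<sigma> (r + 1)"
      using sing_val_eq[OF svd, of "r + 1"] is_svd_nonneg[OF svd] by (auto simp: \<sigma> sing_val_def)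
    then have "s (r - 1) \<noteq> 0" using gt \<sigma>r by linarith
    then have "fro_norm d1 d2 A \<noteq> 0"
      using singular_value_zero_of_zero_matrix[OF svd, of "r - 1"] r rm by force
    then have F: "0 < fro_norm d1 d2 A" by (simp add: order_less_le)
    let ?F = "fro_norm d1 d2 A"
    have d2: "2 \<le> d" using r by linarith
    have d0: "0 < real d" using d2 by simp
    define e where "e = ?F * sqrt (2 * sampling_const * real d / n)"
    have e0: "0 \<le> e" using F n0 sampling_const_pos by (simp add: e_def)
    have K: "0 \<le> sampling_const" using sampling_const_pos by simp
    have ln0: "0 \<le> (1 + \<alpha>) * ln (real d)" using \<alpha> d2 by simp
    have n1: "8 * real d * ((1 + \<alpha>) * ln (real d)) \<le> n"
    proof -
      have "8 * real d * ((1 + \<alpha>) * ln (real d)) \<le> C2 * real d * max ((1 + \<alpha>) * ln (real d)) (?F\<^sup>2 / gap\<^sup>2)"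
        using K ln0 by (intro mult_mono) (auto simp: C2_def)
      then show ?thesis using n by linarith
    qed
    have n2: "8 * sampling_const * real d * (?F\<^sup>2 / gap\<^sup>2) \<le> n"
    proof -
      have "8 * sampling_const * real d * (?F\<^sup>2 / gap\<^sup>2) \<le> C2 * real d * max ((1 + \<alpha>) * ln (real d)) (?F\<^sup>2 / gap\<^sup>2)"
        using K by (intro mult_mono) (auto simp: C2_def)
      then show ?thesis using n by linarith
    qed
    have e_gap: "e \<le> gap / 2"
    proof (rule power2_le_imp_le)
      have "e\<^sup>2 = 2 * sampling_const * real d * ?F\<^sup>2 / n"
        using K n0 by (simp add: e_def power_mult_distrib)
      also have "\<dots> \<le> (gap / 2)\<^sup>2"
        using n2 n0 g0 by (simp add: field_simps)
      finally show "e\<^sup>2 \<le> (gap / 2)\<^sup>2" .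
    qed (use g0 in simp)
    have good: "\<omega> \<in> ?good" if \<omega>: "op_bounded d1 d2 (\<lambda>i j. P_Omega \<omega> p A i j - A i j) e" for \<omega>
    proof (intro CollectI allI impI)
      fix B Ar assume B: "is_trunc_svd d1 d2 (P_Omega \<omega> p A) r B" and Ar: "is_trunc_svd d1 d2 A r Ar"
      have "fro_norm d1 d2 (\<lambda>i j. B i j - Ar i j)
          \<le> sqrt (real r) * e * (4 * (1 + sqrt (\<sigma> (r + 1) * \<sigma> 1) / gap))"
        using trunc_svd_error[OF B Ar r(1) rm \<omega> e0] gt e_gap by (simp add: \<sigma> gap)
      also have "\<dots> = C1 * ?F * sqrt (real r * real d / n) * (1 + sqrt (\<sigma> (r + 1) * \<sigma> 1) / gap)"
        by (simp add: e_def C1_def real_sqrt_mult real_sqrt_divide)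
      finally show "fro_norm d1 d2 (\<lambda>i j. B i j - Ar i j)
          \<le> C1 * ?F * sqrt (real r * real d / n) * (1 + sqrt (\<sigma> (r + 1) * \<sigma> 1) / gap)" .
    qed
    have "1 - real d powr (- \<alpha>)
        \<le> 1 - measure_pmf.prob ?P {\<omega>. \<not> op_bounded d1 d2 (\<lambda>i j. P_Omega \<omega> p A i j - A i j) e}"
      using sampling_error_op_bounded[OF d d2 F \<alpha> n1] by (simp add: e_def p)
    also have "\<dots> = measure_pmf.prob ?P (UNIV - {\<omega>. \<not> op_bounded d1 d2 (\<lambda>i j. P_Omega \<omega> p A i j - A i j) e})"
      using measure_pmf.prob_compl[of "{\<omega>. \<not> op_bounded d1 d2 (\<lambda>i j. P_Omega \<omega> p A i j - A i j) e}" ?P] by simp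
    also have "\<dots> \<le> measure_pmf.prob ?P ?good"
      using good by (intro measure_pmf.finite_measure_mono) auto
    finally show ?thesis .
  qed
  show ?thesis
    using C main by (intro exI[of _ C1] exI[of _ C2]) (simp add: Let_def)
qed

end
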